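(* Let $X$ be a non-empty compact open subset of $\mathbb{Q}_p$ and let $f:X\to X$ be a locally $1$-Lipschitz rational function. Let $l\in\mathbb{Z}$ be such that $B_{p^l}(a)\subset X$ for all $a\in X$ and $|f(x)-f(y)|\le |x-y|$ whenever $a\in X$ and $x,y\in B_{p^l}(a)$. The following statements are equivalent. (1) $f$ is measure-preserving and ergodic. (2) $f$ is minimal. (3) For all integers $t\le l$, the digraph $G(f,p^t)$ consists of a single cycle.
   Context: $|\cdot|$ is the usual $p$-adic absolute value, $B_r(a)=\{x\in\mathbb{Q}_p : |x-a|\le r\}$, and $\mu$ is Haar measure on $\mathbb{Q}_p$ with $\mu(B_{p^k}(a))=p^k$ for all $k\in\mathbb{Z}$. A rational function $f:X\to X$ means $f=P/Q$ with $P,Q\in\mathbb{Z}_p[x]$ coprime, $Q$ having no root in $X$, and $f(X)\subset X$. It is locally $1$-Lipschitz if for every $a\in X$ there is $r>0$ with $|f(x)-f(y)|\le|x-y|$ for all $x,y\in B_r(a)$; on compact open $X$ one can take a single $r=p^l$ valid for all $a$ (and with the balls contained in $X$). Measure-preserving means $\mu(f^{-1}(A))=\mu(A)$ for all Borel $A\subset X$; ergodic means that every Borel $A\subset X$ with $f^{-1}(A)=A$ satisfies $\mu(A)=0$ or $\mu(X\setminus A)=0$. Minimal means that every forward orbit $\{f^n(x): n\ge 0\}$, $x\in X$, is dense in $X$. Digraph $G(f,p^t)$ for an integer $t\le l$: write $X=\bigsqcup_{i=1}^m D_{t,i}$ uniquely as a disjoint union of closed balls of radius $p^t$. The vertices are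 $A_{t,1},\dots,A_{t,m}$, and there is a directed edge from $A_{t,i}$ to $A_{t,j}$ if and only if $f(D_{t,i})\subset D_{t,j}$ (every vertex has outdegree $1$). Consisting of a single cycle means the whole digraph is one directed cycle through all vertices; a loop on a single vertex counts as a cycle of length $1$. *)

theory Defs
  imports
    "HOL-Analysis.Analysis"
    "HOL-Computational_Algebra.Computational_Algebra"
    "Berlekamp_Zassenhaus.Finite_Field"
    "Graph_Theory.Graph_Theory"
begin

section \<open>The $p$-adic absolute value on the rationals\<close>

definition padic_abs :: "nat \<Rightarrow> rat \<Rightarrow> real" where
  "padic_abs p x =
     (if x = 0 then 0
      else real p powi (int (multiplicity (int p) (snd (quotient_of x)))
                      - int (multiplicity (int p) (fst (quotient_of x)))))"

lemma padic_abs_0 [simp]: "padic_abs p 0 = 0"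
  by (simp add: padic_abs_def)

lemma padic_abs_1 [simp]: "padic_abs p 1 = 1"
  by (simp add: padic_abs_def)

lemma padic_abs_minus [simp]: "padic_abs p (- x) = padic_abs p x"
  by (simp add: padic_abs_def rat_uminus_code case_prod_unfold Let_def)

lemma padic_abs_divide:
  assumes p: "prime p" and a: "a \<noteq> 0" and b: "b \<noteq> 0"
  shows "padic_abs p (of_int a / of_int b) =
           real p powi (int (multiplicity (int p) b) - int (multiplicity (int p) a))"
proof -
  let ?x = "of_int a / of_int b :: rat"
  obtain c d where cd: "quotient_of ?x = (c, d)" by fastforce
  have d: "d > 0" using quotient_of_denom_pos[OF cd] .
  have eq: "?x = of_int c / of_int d" using quotient_of_div[OF cd] .
  have x0: "?x \<noteq> 0" using a b by simp
  with eq have c: "c \<noteq> 0" by auto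
  have "(of_int (a * d) :: rat) = of_int (c * b)"
    using eq b d by (simp add: field_simps)
  then have "a * d = c * b" by (simp only: of_int_eq_iff)
  then have "multiplicity (int p) (a * d) = multiplicity (int p) (c * b)" by simp
  then have "multiplicity (int p) a + multiplicity (int p) d =
        multiplicity (int p) c + multiplicity (int p) b"
    using a b c d p by (simp add: prime_elem_multiplicity_mult_distrib)
  then have "int (multiplicity (int p) d) - int (multiplicity (int p) c) =
        int (multiplicity (int p) b) - int (multiplicity (int p) a)" by linarith
  then show ?thesis using x0 cd by (simp add: padic_abs_def)
qed

lemma padic_abs_nonneg [simp]: "0 \<le> padic_abs p x"
  by (simp add: padic_abs_def)

lemma padic_abs_eq_0 [simp]:
  assumes "prime p" shows "padic_abs p x = 0 \<longleftrightarrow> x = 0"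
  using prime_gt_0_nat[OF assms] by (simp add: padic_abs_def)

lemma rat_as_quotient:
  fixes x :: rat
  obtains a b where "b > 0" "x = of_int a / of_int b"
proof -
  obtain a b where "quotient_of x = (a, b)" by fastforce
  then show thesis using that quotient_of_denom_pos quotient_of_div by blast
qed

lemma padic_abs_mult:
  assumes p: "prime p" shows "padic_abs p (x * y) = padic_abs p x * padic_abs p y"
proof (cases "x = 0 \<or> y = 0")
  case False
  obtain a b where b: "b > 0" and x: "x = of_int a / of_int b" by (rule rat_as_quotient)
  obtain c d where d: "d > 0" and y: "y = of_int c / of_int d" by (rule rat_as_quotient)
  from False x y have ac: "a \<noteq> 0" "c \<noteq> 0" by auto
  have xy: "x * y = of_int (a * c) / of_int (b * d)" by (simp add: x y)
  have "padic_abs p (x * y) = real p powi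
     ((int (multiplicity (int p) b) - int (multiplicity (int p) a)) +
      (int (multiplicity (int p) d) - int (multiplicity (int p) c)))"
    unfolding xy using ac b d p
    by (subst padic_abs_divide) (simp_all add: prime_elem_multiplicity_mult_distrib algebra_simps)
  also have "\<dots> = padic_abs p x * padic_abs p y"
    unfolding x y using ac b d p prime_gt_0_nat[OF p]
    by (simp add: padic_abs_divide power_int_add)
  finally show ?thesis .
qed auto

lemma padic_abs_inverse:
  assumes p: "prime p" shows "padic_abs p (inverse x) = inverse (padic_abs p x)"
proof (cases "x = 0")
  case False
  then have "padic_abs p (inverse x) * padic_abs p x = 1"
    by (simp add: padic_abs_mult[OF p, symmetric])
  then show ?thesis by (metis inverse_unique mult.commute)
qed auto

lemma padic_abs_add:
  assumes p: "prime p" shows "padic_abs p (x + y) \<le> max (padic_abs p x) (padic_abs p y)"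
proof (cases "x = 0 \<or> y = 0 \<or> x + y = 0")
  case True
  then show ?thesis
    by (auto simp: le_max_iff_disj)
next
  case False
  obtain a b where b: "b > 0" and x: "x = of_int a / of_int b" by (rule rat_as_quotient)
  obtain c d where d: "d > 0" and y: "y = of_int c / of_int d" by (rule rat_as_quotient)
  define u v w where "u = a * d" "v = c * b" "w = b * d"
  note uvw = this
  have w: "w > 0" using b d by (simp add: uvw)
  have xu: "x = of_int u / of_int w" and yv: "y = of_int v / of_int w"
    using b d by (simp_all add: x y uvw)
  have s: "x + y = of_int (u + v) / of_int w" by (simp add: xu yv add_divide_distrib)
  have nz: "u \<noteq> 0" "v \<noteq> 0" "u + v \<noteq> 0" using False s xu yv by auto
  let ?m = "multiplicity (int p)"
  have nu: "\<not> is_unit (int p)" using p by (simp add: prime_nat_iff)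
  have "min (?m u) (?m v) \<le> ?m (u + v)"
  proof (rule multiplicity_geI)
    show "int p ^ min (?m u) (?m v) dvd u + v"
      by (intro dvd_add multiplicity_dvd') auto
  qed (use nz nu in auto)
  then consider "?m u \<le> ?m (u + v)" | "?m v \<le> ?m (u + v)" by linarith
  moreover have p1: "1 \<le> real p" using prime_ge_1_nat[OF p] by simp
  note eqs = padic_abs_divide[OF p nz(1), of w] padic_abs_divide[OF p nz(2), of w]
    padic_abs_divide[OF p nz(3), of w]
  ultimately show ?thesis
    unfolding s unfolding xu yv le_max_iff_disj using eqs w p1
    by cases (simp_all add: power_int_increasing del: of_int_add)
qed

lemma padic_abs_triangle:
  assumes "prime p" shows "padic_abs p (x + y) \<le> padic_abs p x + padic_abs p y"
  using padic_abs_add[OF assms, of x y] padic_abs_nonneg[of p x] padic_abs_nonneg[of p y]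
  by linarith

lemma padic_abs_diff_commute: "padic_abs p (x - y) = padic_abs p (y - x)"
  by (metis minus_diff_eq padic_abs_minus)

lemma padic_abs_abs_diff:
  assumes p: "prime p" shows "\<bar>padic_abs p x - padic_abs p y\<bar> \<le> padic_abs p (x - y)"
  using padic_abs_triangle[OF p, of "x - y" y] padic_abs_triangle[OF p, of "y - x" x]
    padic_abs_diff_commute[of p x y] by simp


section \<open>The field of $p$-adic numbers\<close>

text \<open>
  $\mathbf{Q}_p$ is the completion of the rationals for \<^const>\<open>padic_abs\<close>, built from Cauchy
  sequences.  The prime $p$ is the cardinality of the index type \<open>'p\<close> of class
  \<^class>\<open>prime_card\<close>, so a statement about all \<open>'p\<close> is a statement about all primes.
\<close>

definition padic_null :: "nat \<Rightarrow> (nat \<Rightarrow> rat) \<Rightarrow> bool" where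
  "padic_null p X \<longleftrightarrow> (\<lambda>n. padic_abs p (X n)) \<longlonglongrightarrow> 0"

definition padic_cauchy :: "nat \<Rightarrow> (nat \<Rightarrow> rat) \<Rightarrow> bool" where
  "padic_cauchy p X \<longleftrightarrow> (\<forall>e>0. \<exists>N. \<forall>m\<ge>N. \<forall>n\<ge>N. padic_abs p (X m - X n) < e)"

lemma padic_null_const [simp]: "prime p \<Longrightarrow> padic_null p (\<lambda>n. c) \<longleftrightarrow> c = 0"
  by (simp add: padic_null_def LIMSEQ_const_iff)

lemma padic_null_minus: "padic_null p (\<lambda>n. - X n) \<longleftrightarrow> padic_null p X"
  by (simp add: padic_null_def)

lemma padic_null_add:
  assumes p: "prime p" and "padic_null p X" "padic_null p Y"
  shows "padic_null p (\<lambda>n. X n + Y n)"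
proof -
  have "(\<lambda>n. padic_abs p (X n) + padic_abs p (Y n)) \<longlonglongrightarrow> 0"
    using tendsto_add[of _ 0 sequentially _ 0] assms(2,3) by (auto simp: padic_null_def)
  then show ?thesis unfolding padic_null_def
    by (rule tendsto_sandwich[OF _ _ tendsto_const, rotated 2])
       (auto intro!: always_eventually padic_abs_triangle p)
qed

lemma padic_null_diff:
  assumes p: "prime p" and "padic_null p X" "padic_null p Y"
  shows "padic_null p (\<lambda>n. X n - Y n)"
  using padic_null_add[OF p assms(2), of "\<lambda>n. - Y n"] assms(3) by (simp add: padic_null_minus)

lemma padic_null_diff_swap: "padic_null p (\<lambda>n. X n - Y n) \<Longrightarrow> padic_null p (\<lambda>n. Y n - X n)"
  by (simp add: padic_null_def padic_abs_diff_commute)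

lemma padic_cauchy_const [simp]: "padic_cauchy p (\<lambda>n. c)"
  by (simp add: padic_cauchy_def)

lemma padic_cauchy_abs_Cauchy:
  assumes p: "prime p" and "padic_cauchy p X"
  shows "Cauchy (\<lambda>n. padic_abs p (X n))"
  using assms(2) unfolding Cauchy_def padic_cauchy_def dist_real_def
  by (meson padic_abs_abs_diff[OF p] le_less_trans)

lemma padic_cauchy_abs_convergent:
  assumes p: "prime p" and "padic_cauchy p X"
  shows "(\<lambda>n. padic_abs p (X n)) \<longlonglongrightarrow> lim (\<lambda>n. padic_abs p (X n))"
  using padic_cauchy_abs_Cauchy[OF assms]
  by (simp add: Cauchy_convergent_iff convergent_LIMSEQ_iff)

lemma padic_cauchy_bounded:
  assumes p: "prime p" and "padic_cauchy p X"
  obtains B where "B > 0" "\<And>n. padic_abs p (X n) \<le> B"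
proof -
  have "Bseq (\<lambda>n. padic_abs p (X n))"
    using padic_cauchy_abs_convergent[OF assms] by (meson convergentI convergent_imp_Bseq)
  then obtain B where "B > 0" "\<forall>n. norm (padic_abs p (X n)) \<le> B" by (rule BseqE)
  then show thesis using that by auto
qed

lemma padic_cauchy_minus: "padic_cauchy p X \<Longrightarrow> padic_cauchy p (\<lambda>n. - X n)"
  unfolding padic_cauchy_def using padic_abs_diff_commute by (simp add: padic_abs_diff_commute)

lemma padic_cauchy_add:
  assumes p: "prime p" and X: "padic_cauchy p X" and Y: "padic_cauchy p Y"
  shows "padic_cauchy p (\<lambda>n. X n + Y n)"
  unfolding padic_cauchy_def
proof (intro allI impI)
  fix e :: real assume e: "e > 0"
  obtain M where M: "\<forall>m\<ge>M. \<forall>n\<ge>M. padic_abs p (X m - X n) < e"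
    using X e unfolding padic_cauchy_def by blast
  obtain N where N: "\<forall>m\<ge>N. \<forall>n\<ge>N. padic_abs p (Y m - Y n) < e"
    using Y e unfolding padic_cauchy_def by blast
  have "padic_abs p (X m + Y m - (X n + Y n)) < e" if "m \<ge> max M N" "n \<ge> max M N" for m n
  proof -
    have "padic_abs p ((X m - X n) + (Y m - Y n)) < e"
      using padic_abs_add[OF p, of "X m - X n" "Y m - Y n"] M N that
      by (smt (verit) max.bounded_iff)
    then show ?thesis by (simp add: algebra_simps)
  qed
  then show "\<exists>N. \<forall>m\<ge>N. \<forall>n\<ge>N. padic_abs p (X m + Y m - (X n + Y n)) < e" by blast
qed

lemma padic_cauchy_mult:
  assumes p: "prime p" and X: "padic_cauchy p X" and Y: "padic_cauchy p Y"
  shows "padic_cauchy p (\<lambda>n. X n * Y n)"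
  unfolding padic_cauchy_def
proof (intro allI impI)
  fix e :: real assume e: "e > 0"
  obtain A where A: "A > 0" "\<And>n. padic_abs p (X n) \<le> A" using padic_cauchy_bounded[OF p X] by blast
  obtain B where B: "B > 0" "\<And>n. padic_abs p (Y n) \<le> B" using padic_cauchy_bounded[OF p Y] by blast
  obtain M where M: "\<forall>m\<ge>M. \<forall>n\<ge>M. padic_abs p (X m - X n) < e / B"
    using X e B unfolding padic_cauchy_def by (meson divide_pos_pos)
  obtain N where N: "\<forall>m\<ge>N. \<forall>n\<ge>N. padic_abs p (Y m - Y n) < e / A"
    using Y e A unfolding padic_cauchy_def by (meson divide_pos_pos)
  have "padic_abs p (X m * Y m - X n * Y n) < e" if mn: "m \<ge> max M N" "n \<ge> max M N" for m n
  proof -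
    have "padic_abs p (X m * (Y m - Y n)) \<le> A * padic_abs p (Y m - Y n)"
      using A by (simp add: padic_abs_mult[OF p] mult_right_mono)
    also have "\<dots> < e" using A N mn by (simp add: field_simps)
    finally have 1: "padic_abs p (X m * (Y m - Y n)) < e" .
    have "padic_abs p ((X m - X n) * Y n) \<le> padic_abs p (X m - X n) * B"
      using B by (simp add: padic_abs_mult[OF p] mult_left_mono)
    also have "\<dots> < e" using B M mn by (simp add: field_simps)
    finally have 2: "padic_abs p ((X m - X n) * Y n) < e" .
    have "X m * Y m - X n * Y n = X m * (Y m - Y n) + (X m - X n) * Y n"
      by (simp add: algebra_simps)
    then show ?thesis using padic_abs_add[OF p, of "X m * (Y m - Y n)" "(X m - X n) * Y n"] 1 2
      by simp
  qed
  then show "\<exists>N. \<forall>m\<ge>N. \<forall>n\<ge>N. padic_abs p (X m * Y m - X n * Y n) < e" by blast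
qed

lemma padic_null_mult:
  assumes p: "prime p" and X: "padic_cauchy p X" and Y: "padic_null p Y"
  shows "padic_null p (\<lambda>n. X n * Y n)"
proof -
  have "(\<lambda>n. padic_abs p (X n) * padic_abs p (Y n)) \<longlonglongrightarrow> lim (\<lambda>n. padic_abs p (X n)) * 0"
    using padic_cauchy_abs_convergent[OF p X] Y unfolding padic_null_def by (rule tendsto_mult)
  then show ?thesis by (simp add: padic_null_def padic_abs_mult[OF p])
qed

lemma padic_not_null_lower:
  assumes p: "prime p" and X: "padic_cauchy p X" and nz: "\<not> padic_null p X"
  obtains b N where "b > 0" "\<And>n. n \<ge> N \<Longrightarrow> b < padic_abs p (X n)"
proof -
  let ?L = "lim (\<lambda>n. padic_abs p (X n))"
  have L: "(\<lambda>n. padic_abs p (X n)) \<longlonglongrightarrow> ?L" by (rule padic_cauchy_abs_convergent[OF p X])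
  have "?L \<ge> 0" using L by (rule LIMSEQ_le_const) auto
  moreover have "?L \<noteq> 0" using nz L unfolding padic_null_def by auto
  ultimately have "?L > 0" by simp
  then have "\<forall>\<^sub>F n in sequentially. ?L / 2 < padic_abs p (X n)"
    by (intro order_tendstoD(1)[OF L]) simp
  then show thesis using that[of "?L / 2"] \<open>?L > 0\<close> unfolding eventually_sequentially
    by (metis half_gt_zero)
qed

lemma padic_abs_inverse_diff:
  assumes p: "prime p" and "b > 0" "b < padic_abs p x" "b < padic_abs p y"
  shows "padic_abs p (inverse x - inverse y) \<le> padic_abs p (x - y) / b\<^sup>2"
proof -
  have nz: "x \<noteq> 0" "y \<noteq> 0" using assms by auto
  then have "inverse x - inverse y = (y - x) * inverse x * inverse y"
    by (simp add: field_simps)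
  then have "padic_abs p (inverse x - inverse y) =
      padic_abs p (x - y) * (inverse (padic_abs p x) * inverse (padic_abs p y))"
    by (simp add: padic_abs_mult[OF p] padic_abs_inverse[OF p] padic_abs_diff_commute mult.assoc)
  also have "\<dots> \<le> padic_abs p (x - y) * (inverse b * inverse b)"
    using assms by (intro mult_left_mono mult_mono le_imp_inverse_le) auto
  finally show ?thesis by (simp add: divide_inverse power2_eq_square)
qed

lemma padic_cauchy_inverse:
  assumes p: "prime p" and X: "padic_cauchy p X" and nz: "\<not> padic_null p X"
  shows "padic_cauchy p (\<lambda>n. inverse (X n))"
  unfolding padic_cauchy_def
proof (intro allI impI)
  fix e :: real assume e: "e > 0"
  obtain b N where b: "b > 0" "\<And>n. n \<ge> N \<Longrightarrow> b < padic_abs p (X n)"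
    using padic_not_null_lower[OF assms] by blast
  obtain M where M: "\<forall>m\<ge>M. \<forall>n\<ge>M. padic_abs p (X m - X n) < e * b\<^sup>2"
    using X e b unfolding padic_cauchy_def by (meson mult_pos_pos zero_less_power)
  have "padic_abs p (inverse (X m) - inverse (X n)) < e"
    if mn: "m \<ge> max M N" "n \<ge> max M N" for m n
  proof -
    have "padic_abs p (inverse (X m) - inverse (X n)) \<le> padic_abs p (X m - X n) / b\<^sup>2"
      using b mn by (intro padic_abs_inverse_diff[OF p]) auto
    also have "\<dots> < e" using M mn b by (simp add: pos_divide_less_eq)
    finally show ?thesis .
  qed
  then show "\<exists>N. \<forall>m\<ge>N. \<forall>n\<ge>N. padic_abs p (inverse (X m) - inverse (X n)) < e" by blast
qed

lemma padic_null_inverse_diff: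
  assumes p: "prime p"
    and X: "padic_cauchy p X" "\<not> padic_null p X"
    and Y: "padic_cauchy p Y" "\<not> padic_null p Y"
    and XY: "padic_null p (\<lambda>n. X n - Y n)"
  shows "padic_null p (\<lambda>n. inverse (X n) - inverse (Y n))"
proof -
  obtain b M where b: "b > 0" "\<And>n. n \<ge> M \<Longrightarrow> b < padic_abs p (X n)"
    using padic_not_null_lower[OF p X] by blast
  obtain c N where c: "c > 0" "\<And>n. n \<ge> N \<Longrightarrow> c < padic_abs p (Y n)"
    using padic_not_null_lower[OF p Y] by blast
  let ?d = "min b c"
  have "(\<lambda>n. padic_abs p (X n - Y n) / ?d\<^sup>2) \<longlonglongrightarrow> 0 / ?d\<^sup>2"
    using XY b c unfolding padic_null_def by (intro tendsto_divide tendsto_const) auto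
  then have lim: "(\<lambda>n. padic_abs p (X n - Y n) / ?d\<^sup>2) \<longlonglongrightarrow> 0" by simp
  have "padic_abs p (inverse (X n) - inverse (Y n)) \<le> padic_abs p (X n - Y n) / ?d\<^sup>2"
    if "n \<ge> max M N" for n
    using b c that by (intro padic_abs_inverse_diff[OF p]) (auto simp: min_less_iff_disj)
  then have "\<forall>\<^sub>F n in sequentially.
      padic_abs p (inverse (X n) - inverse (Y n)) \<le> padic_abs p (X n - Y n) / ?d\<^sup>2"
    unfolding eventually_sequentially by blast
  then show ?thesis unfolding padic_null_def
    by (intro tendsto_sandwich[OF _ _ tendsto_const lim]) auto
qed


typedef (overloaded) 'p padic_seq = "{X. padic_cauchy CARD('p::prime_card) X}"
  morphisms seq_of Abs_padic_seq
  by (rule exI[of _ "\<lambda>_. 0"]) simp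

setup_lifting type_definition_padic_seq

lemma padic_cauchy_seq_of [simp]: "padic_cauchy CARD('p) (seq_of (X :: 'p::prime_card padic_seq))"
  using seq_of[of X] by simp

definition padic_rel :: "'p::prime_card padic_seq \<Rightarrow> 'p padic_seq \<Rightarrow> bool" where
  "padic_rel X Y \<longleftrightarrow> padic_null CARD('p) (\<lambda>n. seq_of X n - seq_of Y n)"

lemma equivp_padic_rel: "equivp (padic_rel :: 'p::prime_card padic_seq \<Rightarrow> _)"
proof (rule equivpI)
  show "reflp (padic_rel :: 'p padic_seq \<Rightarrow> _)"
    by (rule reflpI) (simp add: padic_rel_def prime_card)
  show "symp (padic_rel :: 'p padic_seq \<Rightarrow> _)"
    by (rule sympI) (simp add: padic_rel_def padic_null_diff_swap)
  show "transp (padic_rel :: 'p padic_seq \<Rightarrow> _)"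
  proof (rule transpI)
    fix X Y Z :: "'p padic_seq" assume "padic_rel X Y" "padic_rel Y Z"
    then show "padic_rel X Z"
      using padic_null_add[OF prime_card, where X="\<lambda>n. seq_of X n - seq_of Y n"
        and Y = "\<lambda>n. seq_of Y n - seq_of Z n"]
      by (simp add: padic_rel_def)
  qed
qed

lift_definition seq_const :: "rat \<Rightarrow> 'p::prime_card padic_seq" is "\<lambda>c _. c" by simp

lift_definition seq_add :: "'p::prime_card padic_seq \<Rightarrow> 'p padic_seq \<Rightarrow> 'p padic_seq"
  is "\<lambda>X Y n. X n + Y n" by (rule padic_cauchy_add[OF prime_card])

lift_definition seq_minus :: "'p::prime_card padic_seq \<Rightarrow> 'p padic_seq"
  is "\<lambda>X n. - X n" by (rule padic_cauchy_minus)

lift_definition seq_mult :: "'p::prime_card padic_seq \<Rightarrow> 'p padic_seq \<Rightarrow> 'p padic_seq"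
  is "\<lambda>X Y n. X n * Y n" by (rule padic_cauchy_mult[OF prime_card])

lift_definition seq_inverse :: "'p::prime_card padic_seq \<Rightarrow> 'p padic_seq"
  is "\<lambda>X. if padic_null CARD('p) X then (\<lambda>_. 0) else (\<lambda>n. inverse (X n))"
  using padic_cauchy_inverse[OF prime_card] by auto

lemmas seq_of_ops = seq_const.rep_eq seq_add.rep_eq seq_minus.rep_eq seq_mult.rep_eq
  seq_inverse.rep_eq

quotient_type (overloaded) 'p padic = "'p::prime_card padic_seq" / padic_rel
  by (rule equivp_padic_rel)

instantiation padic :: (prime_card) field
begin

lift_definition zero_padic :: "'a padic" is "seq_const 0" .

lift_definition one_padic :: "'a padic" is "seq_const 1" .

lift_definition plus_padic :: "'a padic \<Rightarrow> 'a padic \<Rightarrow> 'a padic" is seq_add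
proof -
  fix X X' Y Y' :: "'a padic_seq"
  assume "padic_rel X X'" "padic_rel Y Y'"
  then show "padic_rel (seq_add X Y) (seq_add X' Y')"
    using padic_null_add[OF prime_card, where X="\<lambda>n. seq_of X n - seq_of X' n"
        and Y = "\<lambda>n. seq_of Y n - seq_of Y' n"]
    by (simp add: padic_rel_def seq_of_ops algebra_simps)
qed

lift_definition uminus_padic :: "'a padic \<Rightarrow> 'a padic" is seq_minus
proof -
  fix X X' :: "'a padic_seq"
  assume "padic_rel X X'"
  then have "padic_null CARD('a) (\<lambda>n. - (seq_of X n - seq_of X' n))"
    by (simp only: padic_null_minus padic_rel_def)
  then show "padic_rel (seq_minus X) (seq_minus X')"
    by (simp add: padic_rel_def seq_of_ops)
qed

lift_definition times_padic :: "'a padic \<Rightarrow> 'a padic \<Rightarrow> 'a padic" is seq_mult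
proof -
  fix X X' Y Y' :: "'a padic_seq"
  assume "padic_rel X X'" "padic_rel Y Y'"
  then have "padic_null CARD('a) (\<lambda>n. seq_of X n * (seq_of Y n - seq_of Y' n) +
      seq_of Y' n * (seq_of X n - seq_of X' n))"
    unfolding padic_rel_def
    by (intro padic_null_add padic_null_mult prime_card padic_cauchy_seq_of)
  then show "padic_rel (seq_mult X Y) (seq_mult X' Y')"
    by (simp add: padic_rel_def seq_of_ops algebra_simps)
qed

lift_definition inverse_padic :: "'a padic \<Rightarrow> 'a padic" is seq_inverse
proof -
  fix X Y :: "'a padic_seq"
  assume XY: "padic_rel X Y"
  have "padic_null CARD('a) (seq_of X) \<longleftrightarrow> padic_null CARD('a) (seq_of Y)"
  proof
    assume "padic_null CARD('a) (seq_of X)"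
    from padic_null_diff[OF prime_card this XY[unfolded padic_rel_def]]
    show "padic_null CARD('a) (seq_of Y)" by simp
  next
    assume "padic_null CARD('a) (seq_of Y)"
    from padic_null_add[OF prime_card this XY[unfolded padic_rel_def]]
    show "padic_null CARD('a) (seq_of X)" by simp
  qed
  then show "padic_rel (seq_inverse X) (seq_inverse Y)"
    using padic_null_inverse_diff[where p = "CARD('a)" and X = "seq_of X" and Y = "seq_of Y"] XY
    by (auto simp: padic_rel_def seq_of_ops prime_card)
qed

definition minus_padic :: "'a padic \<Rightarrow> 'a padic \<Rightarrow> 'a padic" where "minus_padic x y = x + - y"

definition divide_padic :: "'a padic \<Rightarrow> 'a padic \<Rightarrow> 'a padic" where
  "divide_padic x y = x * inverse y"

instance
proof
  fix a b c :: "'a padic"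
  have eq: "padic_rel X Y" if "\<And>n. seq_of X n = seq_of Y n" for X Y :: "'a padic_seq"
    by (simp add: padic_rel_def that prime_card)
  show "a + b + c = a + (b + c)"
    by transfer (rule eq, simp add: seq_of_ops)
  show "a + b = b + a"
    by transfer (rule eq, simp add: seq_of_ops)
  show "0 + a = a"
    by transfer (rule eq, simp add: seq_of_ops)
  show "- a + a = 0"
    by transfer (rule eq, simp add: seq_of_ops)
  show "a - b = a + - b"
    by (rule minus_padic_def)
  show "a * b * c = a * (b * c)"
    by transfer (rule eq, simp add: seq_of_ops)
  show "a * b = b * a"
    by transfer (rule eq, simp add: seq_of_ops)
  show "1 * a = a"
    by transfer (rule eq, simp add: seq_of_ops)
  show "(a + b) * c = a * c + b * c"
    by transfer (rule eq, simp add: seq_of_ops algebra_simps)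
  show "(0::'a padic) \<noteq> 1"
    by transfer (simp add: padic_rel_def seq_of_ops prime_card)
  show "inverse (0::'a padic) = 0"
    by transfer (rule eq, simp add: seq_of_ops prime_card)
  show "a div b = a * inverse b"
    by (rule divide_padic_def)
  show "inverse a * a = 1" if "a \<noteq> 0"
    using that
  proof transfer
    fix X :: "'a padic_seq"
    assume "\<not> padic_rel X (seq_const 0)"
    then have nn: "\<not> padic_null CARD('a) (seq_of X)" by (simp add: padic_rel_def seq_of_ops)
    obtain b N where b: "b > 0" "\<And>n. n \<ge> N \<Longrightarrow> b < padic_abs CARD('a) (seq_of X n)"
      using padic_not_null_lower[OF prime_card padic_cauchy_seq_of nn] by blast
    have "padic_abs CARD('a) (inverse (seq_of X n) * seq_of X n - 1) = 0" if "n \<ge> N" for n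
    proof -
      have "seq_of X n \<noteq> 0" using b(1) b(2)[OF that] by auto
      then show ?thesis by simp
    qed
    then have "padic_null CARD('a) (\<lambda>n. inverse (seq_of X n) * seq_of X n - 1)"
      unfolding padic_null_def
      by (intro tendsto_eventually) (auto simp: eventually_sequentially)
    then show "padic_rel (seq_mult (seq_inverse X) X) (seq_const 1)"
      using nn by (simp add: padic_rel_def seq_of_ops)
  qed
qed

end

text \<open>
  The library's \<^const>\<open>norm\<close> is reserved for real normed vector spaces, so the absolute value of
  $\mathbf{Q}_p$ gets a constant of its own.  The metric and the topology are the ones it induces,
  so that $B_r(a)$ is \<open>cball a r\<close>.
\<close>

lift_definition padic_norm :: "'a::prime_card padic \<Rightarrow> real"
  is "\<lambda>X. lim (\<lambda>n. padic_abs CARD('a) (seq_of X n))"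
proof -
  fix X Y :: "'a padic_seq"
  assume XY: "padic_rel X Y"
  let ?x = "\<lambda>n. padic_abs CARD('a) (seq_of X n)" and ?y = "\<lambda>n. padic_abs CARD('a) (seq_of Y n)"
  have "(\<lambda>n. ?x n - ?y n) \<longlonglongrightarrow> 0"
  proof (rule Lim_null_comparison)
    show "\<forall>\<^sub>F n in sequentially.
        norm (?x n - ?y n) \<le> padic_abs CARD('a) (seq_of X n - seq_of Y n)"
      by (simp add: padic_abs_abs_diff[OF prime_card])
    show "(\<lambda>n. padic_abs CARD('a) (seq_of X n - seq_of Y n)) \<longlonglongrightarrow> 0"
      using XY by (simp add: padic_rel_def padic_null_def)
  qed
  moreover have "?y \<longlonglongrightarrow> lim ?y"
    by (rule padic_cauchy_abs_convergent[OF prime_card padic_cauchy_seq_of])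
  ultimately have "(\<lambda>n. ?x n - ?y n + ?y n) \<longlonglongrightarrow> 0 + lim ?y" by (rule tendsto_add)
  then show "lim ?x = lim ?y" by (simp add: limI)
qed

lemma padic_cases [case_names abs_padic, cases type: padic]:
  obtains X where "x = abs_padic X"
  using that by (induction x rule: padic.abs_induct) blast

lemma padic_norm_LIMSEQ:
  "(\<lambda>n. padic_abs CARD('p) (seq_of X n)) \<longlonglongrightarrow> padic_norm (abs_padic X :: 'p::prime_card padic)"
  unfolding padic_norm.abs_eq
  by (rule padic_cauchy_abs_convergent[OF prime_card padic_cauchy_seq_of])

lemma padic_norm_nonneg [simp]: "0 \<le> padic_norm (x :: 'p::prime_card padic)"
proof (cases x)
  case (abs_padic X)
  show ?thesis unfolding abs_padic by (rule LIMSEQ_le_const[OF padic_norm_LIMSEQ]) auto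
qed

lemma padic_norm_eq_0 [simp]: "padic_norm x = 0 \<longleftrightarrow> x = (0 :: 'p::prime_card padic)"
proof (cases x)
  case (abs_padic X)
  have "padic_norm x = 0 \<longleftrightarrow> padic_null CARD('p) (seq_of X)"
    using padic_norm_LIMSEQ[of X] LIMSEQ_unique unfolding abs_padic padic_null_def by metis
  then show ?thesis
    unfolding abs_padic zero_padic_def padic.abs_eq_iff padic_rel_def by (simp add: seq_of_ops)
qed

lemma padic_norm_0 [simp]: "padic_norm (0 :: 'p::prime_card padic) = 0"
  by simp

lemma padic_norm_mult: "padic_norm (x * y) = padic_norm x * padic_norm (y :: 'p::prime_card padic)"
proof (cases x; cases y)
  fix X Y assume x: "x = abs_padic X" and y: "y = abs_padic Y"
  have "(\<lambda>n. padic_abs CARD('p) (seq_of (seq_mult X Y) n)) \<longlonglongrightarrow> padic_norm x * padic_norm y"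
    using tendsto_mult[OF padic_norm_LIMSEQ[of X] padic_norm_LIMSEQ[of Y]]
    by (simp add: x y seq_of_ops padic_abs_mult[OF prime_card])
  with padic_norm_LIMSEQ show ?thesis
    unfolding x y times_padic.abs_eq by (rule LIMSEQ_unique)
qed

lemma padic_norm_add: "padic_norm (x + y) \<le> max (padic_norm x) (padic_norm (y :: 'p::prime_card padic))"
proof (cases x; cases y)
  fix X Y assume x: "x = abs_padic X" and y: "y = abs_padic Y"
  have "(\<lambda>n. max (padic_abs CARD('p) (seq_of X n)) (padic_abs CARD('p) (seq_of Y n)))
          \<longlonglongrightarrow> max (padic_norm x) (padic_norm y)"
    unfolding x y by (intro tendsto_max padic_norm_LIMSEQ)
  then show ?thesis
    using padic_norm_LIMSEQ[of "seq_add X Y"] unfolding x y plus_padic.abs_eq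
    by (intro LIMSEQ_le) (auto simp: seq_of_ops intro!: padic_abs_add prime_card)
qed

lemma padic_norm_minus [simp]: "padic_norm (- x) = padic_norm (x :: 'p::prime_card padic)"
proof (cases x)
  case (abs_padic X)
  have "(\<lambda>n. padic_abs CARD('p) (seq_of (seq_minus X) n)) \<longlonglongrightarrow> padic_norm x"
    using padic_norm_LIMSEQ[of X] by (simp add: abs_padic seq_of_ops)
  with padic_norm_LIMSEQ show ?thesis
    unfolding abs_padic uminus_padic.abs_eq by (rule LIMSEQ_unique)
qed

instantiation padic :: (prime_card) metric_space
begin

definition dist_padic :: "'a padic \<Rightarrow> 'a padic \<Rightarrow> real" where "dist_padic x y = padic_norm (x - y)"

definition uniformity_padic :: "('a padic \<times> 'a padic) filter" where
  "uniformity_padic = (INF e\<in>{0<..}. principal {(x, y). dist x y < e})"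

definition open_padic :: "'a padic set \<Rightarrow> bool" where
  "open_padic U \<longleftrightarrow> (\<forall>x\<in>U. eventually (\<lambda>(x', y). x' = x \<longrightarrow> y \<in> U) uniformity)"

instance
proof
  fix x y z :: "'a padic"
  show "dist x y = 0 \<longleftrightarrow> x = y" by (simp add: dist_padic_def)
  have "padic_norm (x - y) \<le> max (padic_norm (x - z)) (padic_norm (z - y))"
    using padic_norm_add[of "x - z" "z - y"] by simp
  also have "\<dots> \<le> padic_norm (x - z) + padic_norm (z - y)" by simp
  also have "padic_norm (z - y) = padic_norm (y - z)" using padic_norm_minus[of "z - y"] by simp
  finally show "dist x y \<le> dist x z + dist y z" by (simp add: dist_padic_def)
qed (simp_all add: uniformity_padic_def open_padic_def)

end

lemma padic_dist_ultra: "dist x z \<le> max (dist x y) (dist y (z :: 'p::prime_card padic))"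
  using padic_norm_add[of "x - y" "y - z"] by (simp add: dist_padic_def)


lemma padic_of_nat: "of_nat k = abs_padic (seq_const (of_nat k) :: 'p::prime_card padic_seq)"
proof (induction k)
  case 0
  then show ?case by (simp add: zero_padic_def)
next
  case (Suc k)
  then show ?case
    by (simp add: one_padic_def plus_padic.abs_eq padic.abs_eq_iff padic_rel_def seq_of_ops
        prime_card)
qed

lemma padic_norm_of_nat: "padic_norm (of_nat k :: 'p::prime_card padic) = padic_abs CARD('p) (of_nat k)"
  by (simp add: padic_of_nat padic_norm.abs_eq seq_of_ops)

lemma padic_norm_CARD: "padic_norm (of_nat CARD('p) :: 'p::prime_card padic) = 1 / real CARD('p)"
proof -
  have p: "prime CARD('p)" by (rule prime_card)
  have "int CARD('p) \<noteq> 0" using prime_gt_0_nat[OF p] by linarith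
  then show ?thesis
    using padic_abs_divide[OF p, of "int CARD('p)" 1] p
    by (simp add: padic_norm_of_nat power_int_minus divide_inverse)
qed

instance padic :: (prime_card) field_char_0
proof
  show "inj (of_nat :: nat \<Rightarrow> 'a padic)"
  proof (rule injI)
    fix m n :: nat assume "of_nat m = (of_nat n :: 'a padic)"
    then show "m = n"
      by (simp add: padic_of_nat padic.abs_eq_iff padic_rel_def seq_of_ops prime_card)
  qed
qed

lemma padic_of_rat: "of_rat r = abs_padic (seq_const r :: 'p::prime_card padic_seq)"
proof -
  obtain a b where b: "b > 0" and r: "r = of_int a / of_int b" by (rule rat_as_quotient)
  have int: "of_int k = abs_padic (seq_const (of_int k) :: 'p padic_seq)" for k
    by (cases k rule: int_diff_cases)
       (simp add: padic_of_nat minus_padic_def uminus_padic.abs_eq plus_padic.abs_eq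
         padic.abs_eq_iff padic_rel_def seq_of_ops prime_card)
  have "of_int b * abs_padic (seq_const r) = (of_int a :: 'p padic)"
    using b r by (simp add: int times_padic.abs_eq padic.abs_eq_iff padic_rel_def seq_of_ops
        prime_card)
  moreover have "of_int b * of_rat r = (of_int a :: 'p padic)" using b r by (simp add: of_rat_divide)
  moreover have "of_int b \<noteq> (0 :: 'p padic)" using b by simp
  ultimately show ?thesis by (metis mult_left_cancel)
qed

theorem padic_norm_of_rat: "padic_norm (of_rat r :: 'p::prime_card padic) = padic_abs CARD('p) r"
  by (simp add: padic_of_rat padic_norm.abs_eq seq_of_ops)

lemma padic_of_rat_approx:
  "(\<lambda>n. of_rat (seq_of X n)) \<longlonglongrightarrow> (abs_padic X :: 'p::prime_card padic)"
  unfolding lim_sequentially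
proof (intro allI impI)
  fix e :: real assume e: "e > 0"
  obtain N where N: "\<forall>m\<ge>N. \<forall>n\<ge>N. padic_abs CARD('p) (seq_of X m - seq_of X n) < e / 2"
    using padic_cauchy_seq_of[of X] e unfolding padic_cauchy_def by (meson half_gt_zero)
  have "dist (of_rat (seq_of X n)) (abs_padic X) < e" if n: "n \<ge> N" for n
  proof -
    let ?Z = "seq_add (seq_const (seq_of X n)) (seq_minus X)"
    have "of_rat (seq_of X n) - abs_padic X = abs_padic ?Z"
      by (simp add: padic_of_rat minus_padic_def uminus_padic.abs_eq plus_padic.abs_eq)
    moreover have "padic_norm (abs_padic ?Z) \<le> e / 2"
      by (rule LIMSEQ_le_const2[OF padic_norm_LIMSEQ])
         (use N n in \<open>auto simp: seq_of_ops intro!: exI[of _ N] less_imp_le\<close>)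
    ultimately show ?thesis using e by (simp add: dist_padic_def)
  qed
  then show "\<exists>N. \<forall>n\<ge>N. dist (of_rat (seq_of X n)) (abs_padic X) < e" by blast
qed

theorem padic_of_rat_dense: "closure (range of_rat) = (UNIV :: 'p::prime_card padic set)"
proof -
  have "x \<in> closure (range of_rat)" for x :: "'p padic"
  proof (cases x)
    case (abs_padic X)
    show ?thesis unfolding abs_padic closure_sequential
      by (intro exI[of _ "\<lambda>n. of_rat (seq_of X n)"] conjI allI rangeI padic_of_rat_approx)
  qed
  then show ?thesis by auto
qed

instance padic :: (prime_card) complete_space
proof
  fix x :: "nat \<Rightarrow> 'a padic"
  assume C: "Cauchy x"
  have "\<exists>r. dist (of_rat r) (x n) < 1 / real (Suc n)" for n
  proof -
    have "x n \<in> closure (range of_rat)" by (simp add: padic_of_rat_dense)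
    then show ?thesis unfolding closure_approachable
      by (metis (no_types, lifting) divide_pos_pos of_nat_0_less_iff rangeE zero_less_Suc zero_less_one)
  qed
  then obtain q where q: "\<And>n. dist (of_rat (q n)) (x n) < 1 / real (Suc n)" by metis
  have lim: "(\<lambda>n. dist (of_rat (q n)) (x n)) \<longlonglongrightarrow> 0"
    by (rule tendsto_sandwich[OF _ _ tendsto_const LIMSEQ_inverse_real_of_nat])
       (use q in \<open>auto simp: inverse_eq_divide intro!: always_eventually less_imp_le\<close>)
  have "padic_cauchy CARD('a) q" unfolding padic_cauchy_def
  proof (intro allI impI)
    fix e :: real assume e: "e > 0"
    obtain M where M: "\<And>m n. m \<ge> M \<Longrightarrow> n \<ge> M \<Longrightarrow> dist (x m) (x n) < e"
      using C e unfolding Cauchy_def by blast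
    obtain N where N: "\<And>n. n \<ge> N \<Longrightarrow> dist (of_rat (q n)) (x n) < e"
      using order_tendstoD(2)[OF lim e] unfolding eventually_sequentially by blast
    have "padic_abs CARD('a) (q m - q n) < e" if "m \<ge> max M N" "n \<ge> max M N" for m n
    proof -
      have "dist (of_rat (q m)) (x n) < e"
        using padic_dist_ultra[of "of_rat (q m)" "x n" "x m"] M N that
        by (smt (verit) max.bounded_iff)
      then have "dist (of_rat (q m)) (of_rat (q n) :: 'a padic) < e"
        using padic_dist_ultra[of "of_rat (q m)" "of_rat (q n)" "x n"] N[of n] that
        by (smt (verit) max.bounded_iff dist_commute)
      then show ?thesis by (simp add: dist_padic_def flip: of_rat_diff padic_norm_of_rat)
    qed
    then show "\<exists>N. \<forall>m\<ge>N. \<forall>n\<ge>N. padic_abs CARD('a) (q m - q n) < e" by blast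
  qed
  then have "seq_of (Abs_padic_seq q :: 'a padic_seq) = q" by (simp add: Abs_padic_seq_inverse)
  then have "(\<lambda>n. of_rat (q n)) \<longlonglongrightarrow> (abs_padic (Abs_padic_seq q) :: 'a padic)"
    using padic_of_rat_approx[of "Abs_padic_seq q :: 'a padic_seq"] by simp
  then obtain L :: "'a padic" where L: "(\<lambda>n. of_rat (q n)) \<longlonglongrightarrow> L" by blast
  then have "(\<lambda>n. dist (of_rat (q n)) L) \<longlonglongrightarrow> 0" by (rule tendsto_dist_iff[THEN iffD1])
  from tendsto_add[OF lim this]
  have "(\<lambda>n. dist (of_rat (q n)) (x n) + dist (of_rat (q n)) L) \<longlonglongrightarrow> 0" by simp
  then have "(\<lambda>n. dist (x n) L) \<longlonglongrightarrow> 0"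
    by (rule tendsto_sandwich[OF _ _ tendsto_const, rotated 2])
       (auto intro!: always_eventually dist_triangle3)
  then have "x \<longlonglongrightarrow> L" by (rule tendsto_dist_iff[THEN iffD2])
  then show "convergent x" by (rule convergentI)
qed


section \<open>Haar measure\<close>

text \<open>The normalisation makes such a measure unique.\<close>

definition padic_haar :: "'p::prime_card padic measure \<Rightarrow> bool" where
  "padic_haar \<mu> \<longleftrightarrow>
     sets \<mu> = sets borel \<and>
     (\<forall>a. \<forall>A\<in>sets borel. emeasure \<mu> ((+) a ` A) = emeasure \<mu> A) \<and>
     (\<forall>a k. emeasure \<mu> (cball a (real CARD('p) powi k)) = ennreal (real CARD('p) powi k))"


section \<open>Rational functions\<close>

definition padic_int_poly :: "'p::prime_card padic poly \<Rightarrow> bool" where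
  "padic_int_poly P \<longleftrightarrow> (\<forall>i. padic_norm (Polynomial.coeff P i) \<le> 1)"

text \<open>
  Coprimality in the ring $\mathbf{Z}_p[x]$: the library's \<^const>\<open>coprime\<close>, with divisors,
  cofactors and inverses ranging over $\mathbf{Z}_p[x]$ instead of $\mathbf{Q}_p[x]$.
\<close>

definition padic_int_coprime :: "'p::prime_card padic poly \<Rightarrow> 'p padic poly \<Rightarrow> bool" where
  "padic_int_coprime P Q \<longleftrightarrow>
     (\<forall>D. padic_int_poly D \<and>
          (\<exists>R. padic_int_poly R \<and> P = D * R) \<and>
          (\<exists>R. padic_int_poly R \<and> Q = D * R) \<longrightarrow>
          (\<exists>R. padic_int_poly R \<and> 1 = D * R))"

text \<open>
  Here and below, maps $X \to X$ are functions on the whole type; their values outside \<open>X\<close>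
  are irrelevant.
\<close>

definition padic_rational_on ::
    "'p::prime_card padic set \<Rightarrow> ('p padic \<Rightarrow> 'p padic) \<Rightarrow> bool" where
  "padic_rational_on X f \<longleftrightarrow>
     (\<exists>P Q. padic_int_poly P \<and> padic_int_poly Q \<and> padic_int_coprime P Q \<and>
            (\<forall>x\<in>X. poly Q x \<noteq> 0) \<and> (\<forall>x\<in>X. f x = poly P x / poly Q x)) \<and>
     f ` X \<subseteq> X"

definition locally_1_lipschitz_on ::
    "'p::prime_card padic set \<Rightarrow> ('p padic \<Rightarrow> 'p padic) \<Rightarrow> bool" where
  "locally_1_lipschitz_on X f \<longleftrightarrow>
     (\<forall>a\<in>X. \<exists>r>0. \<forall>x\<in>cball a r \<inter> X. \<forall>y\<in>cball a r \<inter> X. padic_norm (f x - f y) \<le> padic_norm (x - y))"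


section \<open>Dynamics on a subset\<close>

definition measure_preserving_on :: "'a::topological_space measure \<Rightarrow> 'a set \<Rightarrow> ('a \<Rightarrow> 'a) \<Rightarrow> bool" where
  "measure_preserving_on \<mu> X f \<longleftrightarrow>
     (\<forall>A\<in>sets borel. A \<subseteq> X \<longrightarrow> emeasure \<mu> (f -` A \<inter> X) = emeasure \<mu> A)"

definition ergodic_on :: "'a::topological_space measure \<Rightarrow> 'a set \<Rightarrow> ('a \<Rightarrow> 'a) \<Rightarrow> bool" where
  "ergodic_on \<mu> X f \<longleftrightarrow>
     (\<forall>A\<in>sets borel. A \<subseteq> X \<longrightarrow> f -` A \<inter> X = A \<longrightarrow>
        emeasure \<mu> A = 0 \<or> emeasure \<mu> (X - A) = 0)"

definition minimal_on :: "'a::topological_space set \<Rightarrow> ('a \<Rightarrow> 'a) \<Rightarrow> bool" where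
  "minimal_on X f \<longleftrightarrow> (\<forall>x\<in>X. X \<subseteq> closure (range (\<lambda>n. (f ^^ n) x)))"


section \<open>The digraph on the balls of a given radius\<close>

definition balls_in :: "'a::metric_space set \<Rightarrow> real \<Rightarrow> 'a set set" where
  "balls_in X r = {cball a r | a. cball a r \<subseteq> X}"

text \<open>
  If \<open>X\<close> contains all balls of radius \<open>r\<close> around its points, \<^const>\<open>balls_in\<close> is the unique
  partition of \<open>X\<close> into closed balls of radius \<open>r\<close>; it is finite when \<open>X\<close> is compact.
\<close>

lemma padic_cball_eq:
  assumes "z \<in> cball a r" "z \<in> cball b r"
  shows "cball a r = cball (b :: 'p::prime_card padic) r"
proof -
  have "cball a r \<subseteq> cball b r" if "dist a z \<le> r" "dist b z \<le> r" for a b :: "'p padic"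
  proof
    fix x assume "x \<in> cball a r"
    then have "dist z x \<le> r" using padic_dist_ultra[of z x a] that by (simp add: dist_commute)
    then show "x \<in> cball b r" using padic_dist_ultra[of b x z] that by simp
  qed
  from this[of a b] this[of b a] show ?thesis using assms by auto
qed

lemma padic_open_cball: "r > 0 \<Longrightarrow> open (cball (a :: 'p::prime_card padic) r)"
  unfolding open_contains_cball using padic_cball_eq[of _ a r]
  by (metis centre_in_cball less_imp_le order_refl)

lemma partition_on_balls_in:
  fixes X :: "'p::prime_card padic set"
  assumes r: "r > 0" and X: "\<forall>a\<in>X. cball a r \<subseteq> X"
  shows "partition_on X (balls_in X r)"
proof (rule partition_onI)
  show "\<Union> (balls_in X r) = X"
  proof
    show "X \<subseteq> \<Union> (balls_in X r)"
    proof
      fix x assume "x \<in> X"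
      with X r have "cball x r \<in> balls_in X r" "x \<in> cball x r" by (auto simp: balls_in_def)
      then show "x \<in> \<Union> (balls_in X r)" by blast
    qed
  qed (auto simp: balls_in_def)
  show "disjnt D E" if "D \<in> balls_in X r" "E \<in> balls_in X r" "D \<noteq> E" for D E
    using that padic_cball_eq unfolding balls_in_def disjnt_iff by blast
  show "{} \<notin> balls_in X r" using r by (auto simp: balls_in_def eq_commute[of "{}"])
qed

lemma balls_in_unique:
  fixes X :: "'p::prime_card padic set"
  assumes r: "r > 0" and P: "partition_on X P" "\<forall>D\<in>P. \<exists>a. D = cball a r"
  shows "P = balls_in X r"
proof
  show "P \<subseteq> balls_in X r"
  proof
    fix D assume D: "D \<in> P"
    then obtain a where "D = cball a r" using P(2) by auto
    moreover have "D \<subseteq> X" using D P(1) by (auto simp: partition_on_def)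
    ultimately show "D \<in> balls_in X r" by (auto simp: balls_in_def)
  qed
  show "balls_in X r \<subseteq> P"
  proof
    fix D assume "D \<in> balls_in X r"
    then obtain a where D: "D = cball a r" "cball a r \<subseteq> X" by (auto simp: balls_in_def)
    with r have "a \<in> X" by auto
    then obtain E where E: "E \<in> P" "a \<in> E" using P(1) by (auto simp: partition_on_def)
    then obtain b where "E = cball b r" using P(2) by blast
    with E r have "E = D" using padic_cball_eq[of a b r a] D by simp
    with E show "D \<in> P" by simp
  qed
qed

lemma finite_balls_in:
  fixes X :: "'p::prime_card padic set"
  assumes r: "r > 0" and X: "\<forall>a\<in>X. cball a r \<subseteq> X" and "compact X"
  shows "finite (balls_in X r)"
proof -
  have part: "\<Union> (balls_in X r) = X" "disjoint (balls_in X r)" "{} \<notin> balls_in X r"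
    using partition_on_balls_in[OF r X] by (auto simp: partition_on_def)
  have "\<forall>D\<in>balls_in X r. open D" using r by (auto simp: balls_in_def padic_open_cball)
  then obtain F where F: "F \<subseteq> balls_in X r" "finite F" "X \<subseteq> \<Union> F"
    using compactE[OF \<open>compact X\<close>, of "balls_in X r"] part(1) by (metis order_refl)
  have "balls_in X r \<subseteq> F"
  proof
    fix D assume D: "D \<in> balls_in X r"
    then obtain x where "x \<in> D" using part(3) by (metis ex_in_conv)
    with D part(1) F obtain E where "E \<in> F" "x \<in> E" by blast
    with D F part(2) \<open>x \<in> D\<close> show "D \<in> F" by (metis IntI disjointD empty_iff subsetD)
  qed
  with F show ?thesis using finite_subset by blast
qed

definition ball_digraph ::
    "'a::metric_space set \<Rightarrow> ('a \<Rightarrow> 'a) \<Rightarrow> real \<Rightarrow> ('a set, 'a set \<times> 'a set) pre_digraph" where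
  "ball_digraph X f r =
     \<lparr>verts = balls_in X r,
      arcs = {(D, E). D \<in> balls_in X r \<and> E \<in> balls_in X r \<and> f ` D \<subseteq> E},
      tail = fst, head = snd\<rparr>"

text \<open>
  \<^const>\<open>pre_digraph.cycle\<close> admits loops as cycles of length one.
\<close>

definition single_cycle :: "('a, 'b) pre_digraph \<Rightarrow> bool" where
  "single_cycle G \<longleftrightarrow>
     (\<exists>c. pre_digraph.cycle G c \<and> set c = arcs G \<and> tail G ` set c = verts G)"

end

theory Submission
  imports Defs
begin

text \<open>
  For \<open>t \<le> l\<close> the map \<open>f\<close> sends each ball of radius $p^t$ into a ball of radius $p^t$, so it
  induces a self-map \<open>F\<^sub>t\<close> of the finite set of these balls, and each of the three conditions says
  that every \<open>F\<^sub>t\<close> is transitive.  For the digraphs and for minimality this is immediate.  If all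
  \<open>F\<^sub>t\<close> are transitive, they are bijective, so \<open>f\<close> preserves the measure of balls and hence
  of Borel sets, the balls being a generating \<open>\<pi>\<close>-system; ergodicity needs no density theorem, only the
  same \<open>\<pi>\<close>-system argument.  Conversely, measure preservation makes each \<open>F\<^sub>t\<close> surjective, hence
  bijective, so the union of an \<open>F\<^sub>t\<close>-orbit is an invariant set of positive measure; by ergodicity its
  complement, again a union of balls, is null and therefore empty.
\<close>

subsection \<open>Functional digraphs\<close>

text \<open>\<open>n = 0\<close> is allowed. When \<open>F\<close> maps \<open>V\<close> into
  itself, positive return times come from the pair \<open>F v\<close>, \<open>v\<close>.\<close>

definition transitive_map :: "'a set \<Rightarrow> ('a \<Rightarrow> 'a) \<Rightarrow> bool" where
  "transitive_map V F \<longleftrightarrow> (\<forall>u\<in>V. \<forall>v\<in>V. \<exists>n. (F ^^ n) u = v)"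

lemma funpow_in: "F ` V \<subseteq> V \<Longrightarrow> u \<in> V \<Longrightarrow> (F ^^ n) u \<in> V"
  by (induction n) auto

lemma transitive_map_surj:
  assumes "transitive_map V F" "F ` V \<subseteq> V"
  shows "F ` V = V"
proof
  show "V \<subseteq> F ` V"
  proof
    fix v assume v: "v \<in> V"
    then obtain n where "(F ^^ n) (F v) = v"
      using assms by (fastforce simp: transitive_map_def)
    then have "v = F ((F ^^ n) v)" by (simp add: funpow_swap1)
    then show "v \<in> F ` V" using funpow_in[OF assms(2) v] by blast
  qed
qed fact

text \<open>Arcs are stored as pairs, as in \<open>ball_digraph\<close>, so that the two digraphs
  can be equal as records.\<close>

definition functional_digraph :: "'a set \<Rightarrow> ('a \<Rightarrow> 'a) \<Rightarrow> ('a, 'a \<times> 'a) pre_digraph" where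
  "functional_digraph V F = \<lparr>verts = V, arcs = (\<lambda>v. (v, F v)) ` V, tail = fst, head = snd\<rparr>"

lemma functional_digraph_simps [simp]:
  "verts (functional_digraph V F) = V"
  "arcs (functional_digraph V F) = (\<lambda>v. (v, F v)) ` V"
  "tail (functional_digraph V F) = fst"
  "head (functional_digraph V F) = snd"
  by (simp_all add: functional_digraph_def)

text \<open>The only arc leaving \<open>v\<close> is \<open>(v, F v)\<close>, so the start and the
  length of a walk determine its end.\<close>

lemma functional_digraph_cas:
  assumes "pre_digraph.cas (functional_digraph V F) u c v" "set c \<subseteq> arcs (functional_digraph V F)"
  shows "(F ^^ length c) u = v"
  using assms
  by (induction c arbitrary: u) (auto simp: pre_digraph.cas.simps funpow_swap1)

lemma functional_digraph_orbit_cas: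
  "pre_digraph.cas (functional_digraph V F) u (map (\<lambda>i. ((F ^^ i) u, (F ^^ Suc i) u)) [0..<n]) ((F ^^ n) u)"
proof (induction n arbitrary: u)
  case (Suc n)
  have "map (\<lambda>i. ((F ^^ i) u, (F ^^ Suc i) u)) [0..<Suc n] =
      (u, F u) # map (\<lambda>i. ((F ^^ i) (F u), (F ^^ Suc i) (F u))) [0..<n]"
    by (simp add: map_upt_Suc funpow_swap1 del: upt_Suc)
  then show ?case
    using Suc[of "F u"] by (simp add: pre_digraph.cas.simps funpow_swap1 del: upt_Suc)
qed (simp add: pre_digraph.cas.simps)

text \<open>A closed walk through all vertices leads from any vertex to its base point and on to any
  other. Conversely, the orbit of a point up to its least positive return time exhausts
  \<open>V\<close>, and leastness makes its vertices distinct.\<close>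

theorem single_cycle_functional_digraph_iff:
  assumes V: "V \<noteq> {}" and FV: "F ` V \<subseteq> V"
  shows "single_cycle (functional_digraph V F) \<longleftrightarrow> transitive_map V F"
proof
  let ?G = "functional_digraph V F"
  assume "single_cycle ?G"
  then obtain c w where c: "pre_digraph.cas ?G w c w" "set c = arcs ?G"
    unfolding single_cycle_def pre_digraph.cycle_def pre_digraph.awalk_def by blast
  have through: "\<exists>m n. (F ^^ m) w = v \<and> (F ^^ n) v = w" if v: "v \<in> V" for v
  proof -
    \<comment> \<open>Cut the closed walk just before the arc leaving \<open>v\<close>: the first
      part runs from \<open>w\<close> to \<open>v\<close>, the rest from \<open>v\<close> back to
      \<open>w\<close>.\<close>
    have "(v, F v) \<in> set c" using v c(2) by simp
    then obtain xs ys where xy: "c = xs @ (v, F v) # ys" by (meson split_list)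
    define z where "z = last (pre_digraph.awalk_verts ?G w xs)"
    have "pre_digraph.cas ?G w xs z" "pre_digraph.cas ?G z ((v, F v) # ys) w"
      using c(1) unfolding xy z_def pre_digraph.cas_append_iff by auto
    moreover from this(2) have "z = v" by (simp add: pre_digraph.cas.simps)
    ultimately show ?thesis using functional_digraph_cas[of V F] c(2) unfolding xy
      by (metis Un_subset_iff order_refl set_append)
  qed
  show "transitive_map V F" unfolding transitive_map_def
  proof (intro ballI)
    fix u v assume "u \<in> V" "v \<in> V"
    then obtain m n where "(F ^^ m) u = w" "(F ^^ n) w = v" using through by meson
    then have "(F ^^ (n + m)) u = v" by (simp add: funpow_add)
    then show "\<exists>n. (F ^^ n) u = v" ..
  qed
next
  let ?G = "functional_digraph V F"
  assume tr: "transitive_map V F"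
  obtain u where u: "u \<in> V" using V by blast
  then obtain k where "(F ^^ k) (F u) = u" using tr FV by (fastforce simp: transitive_map_def)
  then have ex: "\<exists>n. n > 0 \<and> (F ^^ n) u = u" by (intro exI[of _ "Suc k"]) (simp add: funpow_swap1)
  define n where "n = (LEAST n. n > 0 \<and> (F ^^ n) u = u)"
  have n: "n > 0" "(F ^^ n) u = u" using LeastI_ex[OF ex] by (auto simp: n_def)
  have least: "n \<le> m" if "m > 0" "(F ^^ m) u = u" for m
    unfolding n_def using that by (intro Least_le) auto
  have orbit: "\<exists>i<n. v = (F ^^ i) u" if v: "v \<in> V" for v
  proof -
    obtain m where "(F ^^ m) u = v"
      using tr[unfolded transitive_map_def, rule_format, OF u v] ..
    then have "v = (F ^^ (m mod n)) u" using funpow_mod_eq[OF n(2)] by simp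
    then show ?thesis using n(1) by (intro exI[of _ "m mod n"]) simp
  qed
  define c where "c = map (\<lambda>i. ((F ^^ i) u, (F ^^ Suc i) u)) [0..<n]"
  have setc: "set c = arcs ?G"
  proof
    show "set c \<subseteq> arcs ?G" using funpow_in[OF FV u] by (auto simp: c_def)
    show "arcs ?G \<subseteq> set c"
    proof
      fix e assume "e \<in> arcs ?G"
      then obtain v where v: "v \<in> V" "e = (v, F v)" by auto
      then obtain i where "i < n" "v = (F ^^ i) u" using orbit by blast
      then show "e \<in> set c" using v by (auto simp: c_def)
    qed
  qed
  have cas: "pre_digraph.cas ?G u c u"
    using functional_digraph_orbit_cas[of V F u n] n by (simp add: c_def)
  \<comment> \<open>\<open>cycle\<close> asks for distinctness of the vertex list without its first
    entry, hence the exponents \<open>Suc i\<close>.\<close>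
  have inj: "inj_on (\<lambda>i. (F ^^ Suc i) u) {0..<n}"
  proof (rule linorder_inj_onI)
    fix i j assume ij: "i < j" "i \<in> {0..<n}" "j \<in> {0..<n}"
    show "(F ^^ Suc i) u \<noteq> (F ^^ Suc j) u"
    proof
      assume "(F ^^ Suc i) u = (F ^^ Suc j) u"
      \<comment> \<open>Advancing both by \<open>n - Suc j\<close> steps brings the second to
        \<open>u\<close>, so the first gives a return after \<open>n - j + i\<close> steps, which is
        positive and less than \<open>n\<close>.\<close>
      then have "(F ^^ (n - Suc j)) ((F ^^ Suc i) u) = (F ^^ (n - Suc j)) ((F ^^ Suc j) u)" by simp
      then have "(F ^^ (n - Suc j + Suc i)) u = (F ^^ (n - Suc j + Suc j)) u"
        by (simp only: funpow_add o_apply)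
      also have "n - Suc j + Suc j = n" using ij by simp
      finally have "(F ^^ (n - Suc j + Suc i)) u = u" using n by simp
      then have "n \<le> n - Suc j + Suc i" by (intro least) auto
      then show False using ij by auto
    qed
  qed auto
  have ne: "c \<noteq> []" using n by (simp add: c_def)
  have "tl (pre_digraph.awalk_verts ?G u c) = map snd c"
    using pre_digraph.awalk_verts_conv'[OF cas] ne by simp
  also have "\<dots> = map (\<lambda>i. (F ^^ Suc i) u) [0..<n]" by (simp add: c_def)
  finally have "distinct (tl (pre_digraph.awalk_verts ?G u c))"
    using inj by (simp add: distinct_map del: funpow.simps)
  then have "pre_digraph.cycle ?G c"
    unfolding pre_digraph.cycle_def pre_digraph.awalk_def using u setc cas ne by auto
  moreover have "tail ?G ` set c = verts ?G" unfolding setc by (auto simp: image_image)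
  ultimately show "single_cycle ?G" using setc unfolding single_cycle_def by blast
qed


subsection \<open>The maps induced on balls\<close>

text \<open>In \<open>lipschitz\<close> one of the two points serves as the centre. This loses
  nothing, since any point of an ultrametric ball is a centre of it.\<close>

locale padic_contraction =
  fixes X :: "'p::prime_card padic set" and f :: "'p padic \<Rightarrow> 'p padic" and q :: real and l :: int
  assumes q: "q > 1" and compact: "compact X" and nonempty: "X \<noteq> {}" and maps: "f ` X \<subseteq> X"
    and ball_sub: "x \<in> X \<Longrightarrow> cball x (q powi l) \<subseteq> X"
    and lipschitz: "x \<in> X \<Longrightarrow> dist x y \<le> q powi l \<Longrightarrow> dist (f x) (f y) \<le> dist x y"
begin

abbreviation rad :: "int \<Rightarrow> real" where "rad t \<equiv> q powi t"

abbreviation balls :: "int \<Rightarrow> 'p padic set set" where "balls t \<equiv> balls_in X (rad t)"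

text \<open>The image of \<open>D\<close> may be smaller than a ball of radius \<open>rad t\<close>,
  so the ball around an image point is taken. For \<open>t <= l\<close> and \<open>D\<close> in
  \<open>balls t\<close> the chosen point does not matter, by \<open>ball_map_cball\<close>.\<close>

definition ball_map :: "int \<Rightarrow> 'p padic set \<Rightarrow> 'p padic set" where
  "ball_map t D = cball (f (SOME x. x \<in> D)) (rad t)"

lemma rad_pos [simp]: "rad t > 0"
  using q by simp

lemma rad_mono: "s \<le> t \<Longrightarrow> rad s \<le> rad t"
  using q by (intro power_int_increasing) auto

lemma rad_small:
  assumes "e > 0" obtains t where "t \<le> l" "rad t < e"
proof -
  obtain n :: nat where n: "inverse e < q ^ n" using real_arch_pow[OF q] by blast
  define t where "t = min l (- int n)"
  have "rad t \<le> rad (- int n)" by (intro rad_mono) (simp add: t_def)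
  also have "\<dots> = inverse (q ^ n)" by (simp add: power_int_minus)
  also have "\<dots> < e" using n assms
    by (metis inverse_inverse_eq inverse_positive_iff_positive less_imp_inverse_less)
  finally show thesis using that[of t] by (simp add: t_def)
qed

text \<open>In an ultrametric space every point of a ball is a centre.\<close>

lemma cball_eq_iff: "cball x (rad t) = cball y (rad t) \<longleftrightarrow> dist x y \<le> rad t"
  for x y :: "'p padic"
proof
  assume "cball x (rad t) = cball y (rad t)"
  then have "y \<in> cball x (rad t)" by (simp add: less_imp_le)
  then show "dist x y \<le> rad t" by simp
next
  assume "dist x y \<le> rad t"
  then have "y \<in> cball x (rad t)" "y \<in> cball y (rad t)" by (simp_all add: less_imp_le)
  then show "cball x (rad t) = cball y (rad t)" by (rule padic_cball_eq)
qed

context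
  fixes t assumes t: "t \<le> l"
begin

lemma cball_sub: "x \<in> X \<Longrightarrow> cball x (rad t) \<subseteq> X"
  using ball_sub rad_mono[OF t] by (meson order_trans subset_cball)

lemma partition: "partition_on X (balls t)"
  by (intro partition_on_balls_in) (auto dest: cball_sub)

lemma finite_balls: "finite (balls t)"
  by (intro finite_balls_in) (auto dest: cball_sub simp: compact)

lemma balls_eq: "balls t = (\<lambda>x. cball x (rad t)) ` X"
proof
  show "balls t \<subseteq> (\<lambda>x. cball x (rad t)) ` X"
  proof
    fix D assume "D \<in> balls t"
    then obtain a where a: "D = cball a (rad t)" "cball a (rad t) \<subseteq> X" by (auto simp: balls_in_def)
    then have "a \<in> X" by (meson centre_in_cball less_imp_le rad_pos subsetD)
    with a show "D \<in> (\<lambda>x. cball x (rad t)) ` X" by blast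
  qed
qed (auto simp: balls_in_def dest: cball_sub)

text \<open>By \<open>cball_eq_iff\<close> the only ball of radius \<open>rad t\<close> containing
  \<open>x\<close> is the one centred at \<open>x\<close>. Questions about points thus become
  questions about vertices.\<close>

lemma mem_Union_balls:
  assumes "U \<subseteq> balls t" "x \<in> X" shows "x \<in> \<Union> U \<longleftrightarrow> cball x (rad t) \<in> U"
proof
  assume "x \<in> \<Union> U"
  then obtain D where D: "D \<in> U" "x \<in> D" by blast
  with assms balls_eq obtain y where "D = cball y (rad t)" by blast
  with D have "D = cball x (rad t)" using cball_eq_iff by simp
  with D show "cball x (rad t) \<in> U" by simp
next
  assume "cball x (rad t) \<in> U"
  then show "x \<in> \<Union> U" by (meson UnionI centre_in_cball less_imp_le rad_pos)
qed

lemma Union_balls_sub: "U \<subseteq> balls t \<Longrightarrow> \<Union> U \<subseteq> X"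
  by (auto simp: balls_in_def)

text \<open>The chosen point lies within \<open>rad t <= rad l\<close> of \<open>x\<close>, so the
  Lipschitz bound keeps the images within \<open>rad t\<close>, where they define the same
  ball.\<close>

lemma ball_map_cball:
  assumes "x \<in> X" shows "ball_map t (cball x (rad t)) = cball (f x) (rad t)"
proof -
  let ?y = "SOME y. y \<in> cball x (rad t)"
  have "x \<in> cball x (rad t)" by (simp add: less_imp_le)
  then have y: "?y \<in> cball x (rad t)" by (rule someI)
  then have "dist (f x) (f ?y) \<le> dist x ?y"
    using lipschitz[OF assms] rad_mono[OF t] by (simp only: mem_cball)
  then have "dist (f x) (f ?y) \<le> rad t" using y by simp
  then show ?thesis unfolding ball_map_def by (simp add: cball_eq_iff dist_commute)
qed

lemma ball_map_balls: "ball_map t ` balls t \<subseteq> balls t"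
  using maps by (auto simp: balls_eq ball_map_cball)

text \<open>Sending a point to its ball is a semiconjugacy from \<open>f\<close> to
  \<open>ball_map t\<close>.\<close>

lemma ball_map_funpow:
  assumes "x \<in> X" shows "(ball_map t ^^ n) (cball x (rad t)) = cball ((f ^^ n) x) (rad t)"
  by (induction n) (auto simp: ball_map_cball funpow_in[OF maps assms])

text \<open>The ball of \<open>f x\<close> depends only on the ball of \<open>x\<close>, so
  preimages can be computed on vertices. This carries measure preservation and invariance over to
  \<open>ball_map t\<close>.\<close>

lemma vimage_Union_balls:
  assumes "U \<subseteq> balls t"
  shows "f -` (\<Union> U) \<inter> X = \<Union> {D \<in> balls t. ball_map t D \<in> U}" (is "?A = \<Union> ?W")
proof -
  have "x \<in> ?A \<longleftrightarrow> x \<in> \<Union> ?W" if x: "x \<in> X" for x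
  proof -
    have "x \<in> ?A \<longleftrightarrow> cball (f x) (rad t) \<in> U"
      using mem_Union_balls[OF assms, of "f x"] x maps by auto
    also have "\<dots> \<longleftrightarrow> cball x (rad t) \<in> ?W" using x by (auto simp: ball_map_cball balls_eq)
    also have "\<dots> \<longleftrightarrow> x \<in> \<Union> ?W" using mem_Union_balls[OF _ x, of ?W] by auto
    finally show ?thesis .
  qed
  then show ?thesis using Union_balls_sub[of ?W] by blast
qed

text \<open>A ball of the partition that contains the image of \<open>D\<close> contains
  \<open>f x\<close> for a centre \<open>x\<close> of \<open>D\<close>, which singles it out; the
  Lipschitz bound gives the converse.\<close>

lemma ball_digraph_eq: "ball_digraph X f (rad t) = functional_digraph (balls t) (ball_map t)"
proof -
  have iff: "f ` cball x (rad t) \<subseteq> E \<longleftrightarrow> E = ball_map t (cball x (rad t))"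
    if x: "x \<in> X" and E: "E \<in> balls t" for x E
  proof
    assume "f ` cball x (rad t) \<subseteq> E"
    then have "f x \<in> \<Union> {E}" by (auto simp: less_imp_le)
    then show "E = ball_map t (cball x (rad t))"
      using mem_Union_balls[of "{E}" "f x"] x E maps by (auto simp: ball_map_cball)
  next
    assume eq: "E = ball_map t (cball x (rad t))"
    show "f ` cball x (rad t) \<subseteq> E"
    proof
      fix z assume "z \<in> f ` cball x (rad t)"
      then obtain y where y: "dist x y \<le> rad t" "z = f y" by auto
      then have "dist (f x) (f y) \<le> rad t"
        using lipschitz[OF x, of y] rad_mono[OF t] by linarith
      then show "z \<in> E" using y eq x by (simp add: ball_map_cball)
    qed
  qed
  have "f ` D \<subseteq> E \<longleftrightarrow> E = ball_map t D"
    if D: "D \<in> balls t" and E: "E \<in> balls t" for D E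
  proof -
    obtain x where "x \<in> X" "D = cball x (rad t)" using D balls_eq by blast
    then show ?thesis using iff[OF _ E] by simp
  qed
  then have "{(D, E). D \<in> balls t \<and> E \<in> balls t \<and> f ` D \<subseteq> E} =
      (\<lambda>D. (D, ball_map t D)) ` balls t"
    using ball_map_balls by blast
  then show ?thesis by (simp add: ball_digraph_def functional_digraph_def)
qed

lemma single_cycle_iff:
  "single_cycle (ball_digraph X f (rad t)) \<longleftrightarrow> transitive_map (balls t) (ball_map t)"
  unfolding ball_digraph_eq using nonempty ball_map_balls
  by (intro single_cycle_functional_digraph_iff) (auto simp: balls_eq)

lemma transitive_balls_iff:
  "transitive_map (balls t) (ball_map t) \<longleftrightarrow> (\<forall>x\<in>X. \<forall>y\<in>X. \<exists>n. dist ((f ^^ n) x) y \<le> rad t)"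
  unfolding transitive_map_def using ball_map_funpow cball_eq_iff by (simp add: balls_eq)

text \<open>Compactness of \<open>X\<close> makes the set of balls finite, so a surjective self-map
  of it is injective.\<close>

lemma inj_ball_map:
  assumes "ball_map t ` balls t = balls t" shows "inj_on (ball_map t) (balls t)"
  using assms finite_balls by (simp add: eq_card_imp_inj_on)

end

text \<open>The radii \<open>rad t\<close> with \<open>t <= l\<close> get arbitrarily small, so
  density of orbits may be tested with them; at a fixed \<open>t\<close>, approximation within
  \<open>rad t\<close> is transitivity on balls.\<close>

lemma minimal_iff: "minimal_on X f \<longleftrightarrow> (\<forall>t\<le>l. transitive_map (balls t) (ball_map t))"
proof -
  have "minimal_on X f \<longleftrightarrow> (\<forall>x\<in>X. \<forall>y\<in>X. \<forall>e>0. \<exists>n. dist ((f ^^ n) x) y < e)"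
    unfolding minimal_on_def by (auto simp: subset_iff closure_approachable)
  also have "\<dots> \<longleftrightarrow> (\<forall>x\<in>X. \<forall>y\<in>X. \<forall>t\<le>l. \<exists>n. dist ((f ^^ n) x) y \<le> rad t)"
    by (meson rad_pos rad_small less_imp_le le_less_trans)
  also have "\<dots> \<longleftrightarrow> (\<forall>t\<le>l. transitive_map (balls t) (ball_map t))"
    using transitive_balls_iff by auto
  finally show ?thesis .
qed

lemma continuous: "continuous_on X f"
  unfolding continuous_on_iff
proof (intro ballI allI impI)
  fix x e assume x: "x \<in> X" and e: "(0::real) < e"
  show "\<exists>d>0. \<forall>x'\<in>X. dist x' x < d \<longrightarrow> dist (f x') (f x) < e"
  proof (intro exI[of _ "min e (rad l)"] conjI ballI impI)
    fix y assume "dist y x < min e (rad l)"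
    then have "dist x y \<le> rad l" "dist x y < e" by (simp_all add: dist_commute)
    then show "dist (f y) (f x) < e" using lipschitz[OF x] by (metis dist_commute le_less_trans)
  qed (use e in simp)
qed


subsection \<open>Measures determined by balls\<close>

text \<open>Radii above \<open>rad l\<close> are left out, since \<open>X\<close> need not contain
  such balls around its points.\<close>

definition all_balls :: "'p padic set set" where
  "all_balls = (\<Union>t\<in>{..l}. balls t)"

lemma all_ballsE:
  assumes "D \<in> all_balls"
  obtains t x where "t \<le> l" "x \<in> X" "D = cball x (rad t)" "D \<in> balls t"
  using assms balls_eq by (auto simp: all_balls_def)

lemma countable_all_balls: "countable all_balls"
  unfolding all_balls_def by (intro countable_UN) (auto intro: countable_finite finite_balls)

text \<open>Two ultrametric balls are nested or disjoint; the empty set is added for the disjoint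
  case.\<close>

lemma Int_stable_all_balls: "Int_stable (insert {} all_balls)"
proof (rule Int_stableI)
  have *: "cball x (rad s) \<inter> cball y (rad t) \<in> {{}, cball x (rad s)}" if "s \<le> t" for x y :: "'p padic" and s t
  proof (cases "cball x (rad s) \<inter> cball y (rad t) = {}")
    case False
    then obtain z where z: "dist x z \<le> rad s" "dist y z \<le> rad t" by auto
    then have "cball x (rad t) = cball y (rad t)"
      using rad_mono[OF that] by (metis cball_eq_iff order_trans)
    moreover have "cball x (rad s) \<subseteq> cball x (rad t)" using rad_mono[OF that] by (rule subset_cball)
    ultimately show ?thesis by blast
  qed simp
  fix D E assume D: "D \<in> insert {} all_balls" and E: "E \<in> insert {} all_balls"
  show "D \<inter> E \<in> insert {} all_balls"
  proof (cases "D = {} \<or> E = {}")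
    case False
    with D E obtain s x t y where "D = cball x (rad s)" "E = cball y (rad t)"
      by (auto elim!: all_ballsE)
    then have "D \<inter> E \<in> {{}, D, E}"
      using *[of s t x y] *[of t s y x] by (metis Int_commute insert_iff linear)
    then show ?thesis using D E by auto
  qed auto
qed

lemma borel_X [measurable]: "X \<in> sets borel"
  using compact by (intro borel_closed compact_imp_closed)

text \<open>A relatively open subset of \<open>X\<close> is the union of the balls inside it, and
  there are only countably many balls.\<close>

lemma sets_restrict_X: "sets (restrict_space borel X) = sigma_sets X (insert {} all_balls)"
proof -
  have sub: "insert {} all_balls \<subseteq> Pow X" by (auto simp: all_balls_def balls_in_def)
  have "sets (restrict_space borel X) = sigma_sets X ((\<inter>) X ` Collect open)"
    unfolding sets_restrict_space using borel_X sigma_sets_Int[of X UNIV "Collect open"]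
    by (simp add: borel_def)
  also have "\<dots> = sigma_sets X (insert {} all_balls)"
  proof (rule sigma_sets_eqI)
    fix D assume "D \<in> insert {} all_balls"
    moreover from this have "D \<subseteq> X" using sub by blast
    ultimately have "open D" "D \<subseteq> X" by (auto simp: padic_open_cball elim!: all_ballsE)
    then show "D \<in> sigma_sets X ((\<inter>) X ` Collect open)"
      by (intro sigma_sets.Basic) (auto intro!: image_eqI[of _ _ D])
  next
    fix A assume "A \<in> (\<inter>) X ` Collect open"
    then obtain U where U: "open U" "A = X \<inter> U" by auto
    have "A = \<Union> {D \<in> all_balls. D \<subseteq> A}"
    proof
      show "A \<subseteq> \<Union> {D \<in> all_balls. D \<subseteq> A}"
      proof
        fix x assume x: "x \<in> A"
        then obtain e where e: "e > 0" "cball x e \<subseteq> U" using U open_contains_cball by blast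
        obtain t where t: "t \<le> l" "rad t < e" using rad_small[OF e(1)] .
        have "x \<in> X" using x U by simp
        then have "cball x (rad t) \<in> balls t" "cball x (rad t) \<subseteq> A"
          using balls_eq[OF t(1)] cball_sub[OF t(1)] subset_cball[of "rad t" e x] t e U by auto
        then show "x \<in> \<Union> {D \<in> all_balls. D \<subseteq> A}" using t
          by (intro UnionI[of "cball x (rad t)"]) (auto simp: all_balls_def less_imp_le)
      qed
    qed auto
    also have "\<dots> \<in> sigma_sets X (insert {} all_balls)"
      by (intro sigma_sets_UNION)
         (auto intro: countable_subset[OF _ countable_all_balls] sigma_sets.Basic)
    finally show "A \<in> sigma_sets X (insert {} all_balls)" .
  qed
  finally show ?thesis .
qed

text \<open>Uniqueness of measures on a generating pi-system; \<open>balls l\<close> serves as the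
  countable cover by sets of finite measure.\<close>

lemma measure_eq_on_balls:
  assumes M: "sets M = sets (restrict_space borel X)" and N: "sets N = sets (restrict_space borel X)"
    and eq: "\<And>t D. t \<le> l \<Longrightarrow> D \<in> balls t \<Longrightarrow> emeasure M D = emeasure N D"
    and fin: "\<And>t D. t \<le> l \<Longrightarrow> D \<in> balls t \<Longrightarrow> emeasure M D \<noteq> \<infinity>"
  shows "M = N"
proof (rule measure_eqI_generator_eq_countable[where A = "balls l" and E = "insert {} all_balls" and \<Omega> = X])
  show "emeasure M D \<noteq> \<infinity>" if "D \<in> balls l" for D using fin[OF order_refl that] .
  show "\<Union> (balls l) = X" using partition by (auto simp: partition_on_def)
  show "countable (balls l)" by (simp add: countable_finite finite_balls)
  show "Int_stable (insert {} all_balls)" by (rule Int_stable_all_balls)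
  show "insert {} all_balls \<subseteq> Pow X" by (auto simp: all_balls_def balls_in_def)
qed (use assms in \<open>auto simp: sets_restrict_X all_balls_def\<close>)

end

section \<open>Haar measure and ergodicity\<close>

locale padic_contraction_haar = padic_contraction X f q l
  for X :: "'p::prime_card padic set" and f q l +
  fixes \<mu> :: "'p padic measure"
  assumes haar: "padic_haar \<mu>" and q_eq: "q = real CARD('p)"
begin

lemma sets_haar [measurable_cong, simp]: "sets \<mu> = sets borel"
  using haar by (simp add: padic_haar_def)

lemma space_haar [simp]: "space \<mu> = UNIV"
  using sets_eq_imp_space_eq[OF sets_haar] by simp

lemma balls_borel: "t \<le> l \<Longrightarrow> D \<in> balls t \<Longrightarrow> D \<in> sets borel"
  by (auto simp: balls_in_def)

lemma emeasure_balls: "t \<le> l \<Longrightarrow> D \<in> balls t \<Longrightarrow> emeasure \<mu> D = ennreal (rad t)"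
  using haar by (auto simp: padic_haar_def balls_in_def q_eq)

lemma emeasure_Int_Union_balls:
  assumes t: "t \<le> l" and U: "U \<subseteq> balls t" and A: "A \<in> sets borel"
  shows "emeasure \<mu> (A \<inter> \<Union> U) = (\<Sum>D\<in>U. emeasure \<mu> (A \<inter> D))"
proof -
  have dis: "disjoint U" using partition[OF t] U by (meson partition_on_def pairwise_subset)
  have "A \<inter> \<Union> U = (\<Union>D\<in>U. A \<inter> D)" by auto
  also have "emeasure \<mu> \<dots> = (\<Sum>D\<in>U. emeasure \<mu> (A \<inter> D))"
  proof (rule sum_emeasure[symmetric])
    show "(\<lambda>D. A \<inter> D) ` U \<subseteq> sets \<mu>" using A U balls_borel[OF t] by auto
    show "disjoint_family_on (\<lambda>D. A \<inter> D) U"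
      using dis by (auto simp: disjoint_family_on_def disjoint_def)
    show "finite U" using U finite_balls[OF t] finite_subset by blast
  qed
  finally show ?thesis .
qed

text \<open>Lets a null union of balls be recognised as empty.\<close>

lemma emeasure_Union_balls_pos:
  assumes t: "t \<le> l" and U: "U \<subseteq> balls t" "U \<noteq> {}"
  shows "emeasure \<mu> (\<Union> U) \<noteq> 0"
proof -
  obtain D where D: "D \<in> U" using U by blast
  have "\<Union> U \<in> sets \<mu>"
    using U finite_balls[OF t] finite_subset balls_borel[OF t] by (intro sets.finite_Union) auto
  then have "emeasure \<mu> D \<le> emeasure \<mu> (\<Union> U)" using D by (intro emeasure_mono) auto
  moreover have "emeasure \<mu> D > 0" using emeasure_balls[OF t, of D] D U by auto
  ultimately show ?thesis by auto
qed

lemma transitive_if_ergodic: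
  assumes t: "t \<le> l" and mp: "measure_preserving_on \<mu> X f" and erg: "ergodic_on \<mu> X f"
  shows "transitive_map (balls t) (ball_map t)"
proof -
  \<comment> \<open>A ball outside the image would have an empty preimage, yet measure preservation
    gives that preimage the measure \<open>rad t > 0\<close>.\<close>
  have "E \<in> ball_map t ` balls t" if E: "E \<in> balls t" for E
  proof (rule ccontr)
    assume "E \<notin> ball_map t ` balls t"
    then have "{D \<in> balls t. ball_map t D \<in> {E}} = {}" by auto
    moreover have "f -` E \<inter> X = \<Union> {D \<in> balls t. ball_map t D \<in> {E}}"
      using vimage_Union_balls[OF t, of "{E}"] E by simp
    ultimately have "f -` E \<inter> X = {}" by (simp only: Union_empty)
    moreover have "emeasure \<mu> (f -` E \<inter> X) = emeasure \<mu> E"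
      using mp balls_borel[OF t E] E by (auto simp: measure_preserving_on_def balls_in_def)
    ultimately show False using emeasure_balls[OF t E] rad_pos[of t] by simp
  qed
  then have inj: "inj_on (ball_map t) (balls t)"
    using ball_map_balls[OF t] by (intro inj_ball_map t) blast
  show ?thesis unfolding transitive_map_def
  proof (intro ballI)
    fix D E assume D: "D \<in> balls t" and E: "E \<in> balls t"
    define U where "U = range (\<lambda>n. (ball_map t ^^ n) D)"
    have U: "U \<subseteq> balls t" "D \<in> U"
      using funpow_in[OF ball_map_balls[OF t] D] by (auto simp: U_def intro: image_eqI[of _ _ 0])
    have fwd: "ball_map t ` U \<subseteq> U"
      by (auto simp: U_def intro: range_eqI[of _ _ "Suc n" for n])
    have "finite U" using U finite_balls[OF t] finite_subset by blast
    \<comment> \<open>On the finite set \<open>U\<close> the injective map is onto, so every ball of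
      \<open>U\<close> already has its unique preimage in \<open>U\<close> and no ball outside
      \<open>U\<close> enters it.\<close>
    then have "ball_map t ` U = U" using fwd inj U by (intro endo_inj_surj) (auto intro: inj_on_subset)
    then have "{D \<in> balls t. ball_map t D \<in> U} = U"
      using inj U by (auto simp: inj_on_def) blast
    then have "f -` (\<Union> U) \<inter> X = \<Union> U" using vimage_Union_balls[OF t U(1)] by simp
    moreover have "\<Union> U \<in> sets borel"
      using U \<open>finite U\<close> balls_borel[OF t] by (intro sets.finite_Union) auto
    ultimately have "emeasure \<mu> (X - \<Union> U) = 0"
      using erg Union_balls_sub[OF t U(1)] emeasure_Union_balls_pos[OF t U(1)] U(2)
      unfolding ergodic_on_def by blast
    moreover have "X - \<Union> U = \<Union> (balls t - U)"
    proof -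
      have "x \<in> \<Union> (balls t - U) \<longleftrightarrow> x \<notin> \<Union> U" if x: "x \<in> X" for x
        using mem_Union_balls[OF t _ x, of U] mem_Union_balls[OF t _ x, of "balls t - U"] U(1)
          balls_eq[OF t] x by blast
      then show ?thesis using Union_balls_sub[OF t, of "balls t - U"] by blast
    qed
    ultimately have "balls t - U = {}"
      using emeasure_Union_balls_pos[OF t, of "balls t - U"] by auto
    then show "\<exists>n. (ball_map t ^^ n) D = E" using E by (auto simp: U_def)
  qed
qed

text \<open>Injectivity leaves no other ball with the same image.\<close>

lemma vimage_ball:
  assumes t: "t \<le> l" and inj: "inj_on (ball_map t) (balls t)" and D: "D \<in> balls t"
  shows "f -` (ball_map t D) \<inter> X = D"
proof -
  have "{D' \<in> balls t. ball_map t D' \<in> {ball_map t D}} = {D}"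
    using inj D by (auto simp: inj_on_def)
  then show ?thesis
    using vimage_Union_balls[OF t, of "{ball_map t D}"] ball_map_balls[OF t] D by auto
qed

text \<open>Continuity makes \<open>f\<close> measurable on \<open>X\<close>, so the claim becomes
  the equality of the restricted Haar measure with its image measure, which is tested on
  balls.\<close>

lemma measure_preserving_if_surj:
  assumes surj: "\<And>t. t \<le> l \<Longrightarrow> ball_map t ` balls t = balls t"
  shows "measure_preserving_on \<mu> X f"
proof -
  let ?M = "restrict_space \<mu> X"
  have setsM: "sets ?M = sets (restrict_space borel X)"
    by (intro sets_restrict_space_cong sets_haar)
  have "f \<in> borel_measurable (restrict_space borel X)"
    by (rule borel_measurable_continuous_on_restrict[OF continuous])
  then have "f \<in> restrict_space borel X \<rightarrow>\<^sub>M restrict_space borel X"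
    using maps by (intro measurable_restrict_space2) (auto simp: space_restrict_space)
  then have meas: "f \<in> ?M \<rightarrow>\<^sub>M ?M"
    using measurable_cong_sets[OF setsM setsM] by simp
  have em: "emeasure ?M A = emeasure \<mu> A" if "A \<subseteq> X" for A
    using that by (intro emeasure_restrict_space) auto
  have in_M: "A \<in> sets ?M" if "A \<in> sets borel" "A \<subseteq> X" for A
    using that by (auto simp: sets_restrict_space)
  have emd: "emeasure (distr ?M ?M f) A = emeasure \<mu> (f -` A \<inter> X)"
    if "A \<in> sets borel" "A \<subseteq> X" for A
    using meas in_M[OF that] by (subst emeasure_distr) (auto simp: em space_restrict_space)
  have eq: "emeasure (distr ?M ?M f) E = ennreal (rad t) \<and> emeasure ?M E = ennreal (rad t)"
    if t: "t \<le> l" and E: "E \<in> balls t" for t E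
  proof -
    obtain D where D: "D \<in> balls t" "E = ball_map t D" using surj[OF t] E by blast
    then have "f -` E \<inter> X = D" using vimage_ball[OF t inj_ball_map[OF t surj[OF t]]] by simp
    moreover have "E \<subseteq> X" using E by (auto simp: balls_in_def)
    ultimately show ?thesis
      using emd[of E] em[of E] E D emeasure_balls[OF t] balls_borel[OF t] by simp
  qed
  have "distr ?M ?M f = ?M"
    by (rule measure_eq_on_balls) (use eq setsM in auto)
  then show ?thesis unfolding measure_preserving_on_def using emd em by metis
qed

lemma ergodic_if_transitive:
  assumes mp: "measure_preserving_on \<mu> X f"
    and tr: "\<And>t. t \<le> l \<Longrightarrow> transitive_map (balls t) (ball_map t)"
  shows "ergodic_on \<mu> X f"
  \<comment> \<open>For invariant \<open>A\<close>, transitivity gives all balls \<open>D\<close> of one radius the same \<open>\<mu> (A \<inter> D)\<close>.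
    So \<open>\<mu> (A \<inter> D) / \<mu> A = \<mu> D / \<mu> X\<close> for all balls, hence for all Borel sets; take \<open>X - A\<close>
    instead of \<open>D\<close>.\<close>
  unfolding ergodic_on_def
proof (intro ballI impI)
  fix A assume A: "A \<in> sets borel" "A \<subseteq> X" and inv: "f -` A \<inter> X = A"
  show "emeasure \<mu> A = 0 \<or> emeasure \<mu> (X - A) = 0"
  proof (cases "emeasure \<mu> A = 0")
    case nz: False
    let ?M = "restrict_space \<mu> X"
    have setsM: "sets ?M = sets (restrict_space borel X)"
      by (intro sets_restrict_space_cong sets_haar)
    have em: "emeasure ?M B = emeasure \<mu> B" if "B \<subseteq> X" for B
      using that by (intro emeasure_restrict_space) auto
    have in_M: "B \<in> sets ?M" if "B \<in> sets borel" "B \<subseteq> X" for B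
      using that by (auto simp: sets_restrict_space)
    have const: "emeasure \<mu> (A \<inter> D) = emeasure \<mu> (A \<inter> E)"
      if t: "t \<le> l" and D: "D \<in> balls t" and E: "E \<in> balls t" for t D E
    proof -
      have inj: "inj_on (ball_map t) (balls t)"
        using transitive_map_surj[OF tr[OF t] ball_map_balls[OF t]] by (rule inj_ball_map[OF t])
      have step: "emeasure \<mu> (A \<inter> ball_map t C) = emeasure \<mu> (A \<inter> C)" if C: "C \<in> balls t" for C
      proof -
        \<comment> \<open>Invariance of \<open>A\<close> and injectivity on balls give the exact
          preimage, to which measure preservation applies.\<close>
        have "f -` (A \<inter> ball_map t C) \<inter> X = A \<inter> C" using inv vimage_ball[OF t inj C] by auto
        moreover have "ball_map t C \<in> sets borel" using ball_map_balls[OF t] C balls_borel[OF t] by blast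
        ultimately show ?thesis using mp A unfolding measure_preserving_on_def
          by (metis le_infI1 sets.Int)
      qed
      have "emeasure \<mu> (A \<inter> (ball_map t ^^ n) D) = emeasure \<mu> (A \<inter> D)" for n
        by (induction n) (simp_all add: step funpow_in[OF ball_map_balls[OF t] D])
      then show ?thesis using tr[OF t] D E unfolding transitive_map_def by metis
    qed
    have fin: "emeasure \<mu> (B \<inter> D) \<noteq> \<infinity>" if "t \<le> l" "D \<in> balls t" for B t D
    proof -
      have "emeasure \<mu> (B \<inter> D) \<le> emeasure \<mu> D"
        using balls_borel[OF that] by (intro emeasure_mono) auto
      then show ?thesis using emeasure_balls[OF that] by (auto simp: top_unique)
    qed
    \<comment> \<open>Stated for a general \<open>B\<close>, since it serves both \<open>A\<close>
      and \<open>X\<close>.\<close>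
    have split: "emeasure \<mu> B = of_nat (card (balls t)) * emeasure \<mu> (B \<inter> D)"
      if t: "t \<le> l" and D: "D \<in> balls t" and B: "B \<in> sets borel" "B \<subseteq> X"
        and c: "\<And>E. E \<in> balls t \<Longrightarrow> emeasure \<mu> (B \<inter> E) = emeasure \<mu> (B \<inter> D)" for t D B
    proof -
      have "B = B \<inter> \<Union> (balls t)" using B partition[OF t] by (auto simp: partition_on_def)
      then have "emeasure \<mu> B = (\<Sum>E\<in>balls t. emeasure \<mu> (B \<inter> E))"
        using emeasure_Int_Union_balls[OF t order_refl B(1)] by simp
      also have "\<dots> = (\<Sum>E\<in>balls t. emeasure \<mu> (B \<inter> D))" by (rule sum.cong[OF refl c])
      finally show ?thesis by simp
    qed
    have unif: "emeasure (uniform_measure ?M B) D = 1 / of_nat (card (balls t))"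
      if t: "t \<le> l" and D: "D \<in> balls t" and B: "B \<in> sets borel" "B \<subseteq> X" "emeasure \<mu> B \<noteq> 0"
        and c: "\<And>E. E \<in> balls t \<Longrightarrow> emeasure \<mu> (B \<inter> E) = emeasure \<mu> (B \<inter> D)" for t D B
    proof -
      have *: "emeasure \<mu> B = of_nat (card (balls t)) * emeasure \<mu> (B \<inter> D)"
        by (rule split[OF t D B(1,2) c])
      have "D \<subseteq> X" using D by (auto simp: balls_in_def)
      then have "emeasure (uniform_measure ?M B) D = emeasure \<mu> (B \<inter> D) / emeasure \<mu> B"
        using in_M B balls_borel[OF t D] by (subst emeasure_uniform_measure) (auto simp: em le_infI1)
      also have "\<dots> = 1 * emeasure \<mu> (B \<inter> D) / (of_nat (card (balls t)) * emeasure \<mu> (B \<inter> D))"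
        using * by simp
      \<comment> \<open>Cancelling in \<open>ennreal\<close> requires a finite nonzero factor; it is
        nonzero because \<open>emeasure \<mu> B\<close> is.\<close>
      also have "\<dots> = 1 / of_nat (card (balls t))"
        using fin[OF t D, of B] B(3) * by (intro divide_mult_eq) auto
      finally show ?thesis .
    qed
    have constX: "emeasure \<mu> (X \<inter> D) = emeasure \<mu> (X \<inter> E)"
      if t: "t \<le> l" and D: "D \<in> balls t" and E: "E \<in> balls t" for t D E
    proof -
      have "X \<inter> D = D" "X \<inter> E = E" using D E by (auto simp: balls_in_def)
      then show ?thesis using emeasure_balls[OF t] D E by simp
    qed
    have X_nz: "emeasure \<mu> X \<noteq> 0" using nz emeasure_mono[OF A(2), of \<mu>] by auto
    have X_fin: "emeasure \<mu> X \<noteq> \<infinity>"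
    proof -
      obtain D where D: "D \<in> balls l" using nonempty balls_eq[of l] by auto
      have "emeasure \<mu> X = of_nat (card (balls l)) * emeasure \<mu> (X \<inter> D)"
        by (rule split[OF order_refl D borel_X order_refl constX[OF order_refl _ D]])
      then show ?thesis using fin[OF order_refl D, of X] by (auto simp: ennreal_mult_eq_top_iff)
    qed
    \<comment> \<open>Excludes \<open>1 / 0\<close>, which is infinite in \<open>ennreal\<close>;
      \<open>measure_eq_on_balls\<close> asks for finite values.\<close>
    have card_pos: "card (balls t) > 0" if t: "t \<le> l" for t
      using finite_balls[OF t] balls_eq[OF t] nonempty by (simp add: card_gt_0_iff)
    have unifA: "emeasure (uniform_measure ?M A) D = 1 / of_nat (card (balls t))"
      if "t \<le> l" "D \<in> balls t" for t D
      by (rule unif[OF that A nz const[OF that(1) _ that(2)]])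
    have unifX: "emeasure (uniform_measure ?M X) D = 1 / of_nat (card (balls t))"
      if "t \<le> l" "D \<in> balls t" for t D
      by (rule unif[OF that borel_X order_refl X_nz constX[OF that(1) _ that(2)]])
    have "uniform_measure ?M A = uniform_measure ?M X"
      by (rule measure_eq_on_balls)
         (use unifA unifX card_pos setsM in \<open>auto simp: ennreal_divide_eq_top_iff\<close>)
    moreover have "emeasure (uniform_measure ?M A) (X - A) = 0"
      using in_M A by (subst emeasure_uniform_measure) auto
    moreover have "emeasure (uniform_measure ?M X) (X - A) = emeasure \<mu> (X - A) / emeasure \<mu> X"
      using in_M A by (subst emeasure_uniform_measure) (auto simp: em Int_absorb1)
    \<comment> \<open>A quotient in \<open>ennreal\<close> also vanishes when the denominator is
      infinite; \<open>X_fin\<close> rules this out.\<close>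
    ultimately show ?thesis using X_fin by (simp add: ennreal_divide_eq_0_iff)
  qed simp
qed

theorem ergodic_iff:
  "measure_preserving_on \<mu> X f \<and> ergodic_on \<mu> X f \<longleftrightarrow>
     (\<forall>t\<le>l. transitive_map (balls t) (ball_map t))"
  using transitive_if_ergodic ergodic_if_transitive measure_preserving_if_surj
    transitive_map_surj ball_map_balls by metis

end

theorem theorem3p2:
  fixes \<mu> :: "'p::prime_card padic measure"
    and X :: "'p padic set"
    and f :: "'p padic \<Rightarrow> 'p padic"
    and l :: int
  assumes "padic_haar \<mu>"
    and "X \<noteq> {}" and "compact X" and "open X"
    and "padic_rational_on X f"
    and "locally_1_lipschitz_on X f"
    and "\<forall>a\<in>X. cball a (real CARD('p) powi l) \<subseteq> X"
    and "\<forall>a\<in>X. \<forall>x\<in>cball a (real CARD('p) powi l). \<forall>y\<in>cball a (real CARD('p) powi l).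
           padic_norm (f x - f y) \<le> padic_norm (x - y)"
  shows "((measure_preserving_on \<mu> X f \<and> ergodic_on \<mu> X f) \<longleftrightarrow> minimal_on X f) \<and>
         (minimal_on X f \<longleftrightarrow>
            (\<forall>t\<le>l. single_cycle (ball_digraph X f (real CARD('p) powi t))))"
proof -
  \<comment> \<open>\<open>lipschitz\<close> is the hypothesis on \<open>f\<close> with the point
    \<open>x\<close> itself as the centre \<open>a\<close>.\<close>
  interpret padic_contraction_haar X f "real CARD('p)" l \<mu>
    by unfold_locales
       (use assms prime_gt_1_nat[OF prime_card[where 'a='p]] in \<open>auto simp: padic_rational_on_def dist_padic_def\<close>)
  show ?thesis using ergodic_iff minimal_iff single_cycle_iff by auto
qed

end
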